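(* Let $p,q,\upsilon,\sigma,\tau,w_1,w_2,\gamma_1,\gamma_2,\gamma_3,\mu_1,\mu_2,\mu_3\in\mathbb{C}$ with $\operatorname{Re}(p)>0$, $\operatorname{Re}(q)>0$, $\operatorname{Re}(\upsilon)>0$, $\operatorname{Re}(\sigma)>0$, $\operatorname{Re}(\tau)>0$, and let $a_1<a_2$, $b_1<b_2$ be real. Put $\gamma=(\gamma_1,\gamma_2,\gamma_3)$, $\mu=(\mu_1,\mu_2,\mu_3)$. Then for every summable function $d\in L((a_1,a_2)\times(b_1,b_2))$, $$\left(\mathfrak{E}_{\frac{\gamma_{1}+1}{2},\gamma_{2},\gamma_{3};p,q,\upsilon;w_{1},w_{2};a_{1}^{+},b_{1}^{+}}^{(\gamma)}\;\mathfrak{E}_{\frac{\mu_{1}+1}{2},\mu_{2},\mu_{3};\sigma,\tau,\upsilon;w_{1},w_{2};a_{1}^{+},b_{1}^{+}}^{(\mu)}d\right)(z,t)=\left(\mathfrak{E}_{\frac{\gamma_{1}+\mu_{1}+1}{2},\gamma_{2}+\mu_{2},\gamma_{3}+\mu_{3};p+\sigma,q+\tau,\upsilon;w_{1},w_{2};a_{1}^{+},b_{1}^{+}}^{(\gamma+\mu)}d\right)(z,t).$$ In particular, $$\left(\mathfrak{E}_{\frac{\gamma_{1}+1}{2},\gamma_{2},\gamma_{3};p,q,\upsilon;w_{1},w_{2};a_{1}^{+},b_{1}^{+}}^{(\gamma)}\;\mathfrak{E}_{\frac{-\gamma_{1}+1}{2},-\gamma_{2},-\gamma_{3};\sigma,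\tau,\upsilon;w_{1},w_{2};a_{1}^{+},b_{1}^{+}}^{(-\gamma)}d\right)(z,t)=\left({}_{t}\mathbb{I}_{b_{1}^{+}}^{q+\tau}\,{}_{z}\mathbb{I}_{a_{1}^{+}}^{p+\sigma}d\right)(z,t).$$
   Context: $(a)_n$ is the Pochhammer symbol. The integral operator is $$\left(\mathfrak{E}_{\frac{\gamma_{1}+1}{2},\gamma_{2},\gamma_{3};p,q,\upsilon;w_{1},w_{2};a_{1}^{+},b_{1}^{+}}^{(\gamma)}d\right)(z,t)=\int_{b_1}^{t}\int_{a_1}^{z}(t-y)^{q-1}(z-\xi)^{p-1}E_{\frac{\gamma_{1}+1}{2},\gamma_{2},\gamma_{3};p;q;\upsilon}^{(\gamma_{1};\gamma_{2};\gamma_{3})}(w_{1}(z-\xi),w_{2}(t-y))\,d(\xi,y)\,d\xi\,dy,$$ with kernel the modified I-Konhauser Mittag-Leffler function $\sum_{l,n\ge0}\frac{(-1)^{l}(\gamma_{1})_{2l}(\gamma_{2})_{l+n}(\gamma_{3})_{l}z^{l}t^{\upsilon n}}{(\gamma_{4})_{l}(\gamma_{5})_{l}(\gamma_{6})_{l}\Gamma(p+l)\Gamma(q+\upsilon n)n!l!}$ taken at $\gamma_4=\frac{\gamma_1+1}{2},\gamma_5=\gamma_2,\gamma_6=\gamma_3$, where equal parameters are cancelled before substituting values, i.e. for all complex $\gamma_1,\gamma_2,\gamma_3$ $$E_{\frac{\gamma_{1}+1}{2},\gamma_{2},\gamma_{3};p;q;\upsilon}^{(\gamma_{1};\gamma_{2};\gamma_{3})}(z,t)=\sum_{l=0}^{\infty}\sum_{n=0}^{\infty}\frac{(-4)^{l}\left(\frac{\gamma_{1}}{2}\right)_{l}(\gamma_{2}+l)_{n}\,z^{l}t^{\upsilon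 n}}{\Gamma(p+l)\,\Gamma(q+\upsilon n)\,n!\,l!}.$$ For $s>0$, $(w_2s)^{\upsilon n}$ means $(w_2^{\upsilon})^n s^{\upsilon n}$ with a fixed choice of $w_2^\upsilon$ (and $w_2^{\upsilon}=0$ if $w_2=0$). $({}_{t}\mathbb{I}_{b_1^{+}}^{\tau}\,{}_{z}\mathbb{I}_{a_1^{+}}^{\sigma}d)(z,t)=\frac{1}{\Gamma(\sigma)\Gamma(\tau)}\int_{b_1}^t\int_{a_1}^z(z-\xi)^{\sigma-1}(t-y)^{\tau-1}d(\xi,y)\,d\xi\,dy$. $L((a_1,a_2)\times(b_1,b_2))$ is the space of Lebesgue integrable functions on the rectangle; equalities of its elements are almost everywhere. *)

theory Defs
  imports "HOL-Analysis.Analysis"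
begin

text \<open>
  \<open>is_cpower w v c\<close>: \<open>c\<close> is one of the values of the multivalued power \<open>w\<close> to the \<open>v\<close>,
  with the convention that the power of 0 is 0.
\<close>

definition is_cpower :: "complex \<Rightarrow> complex \<Rightarrow> complex \<Rightarrow> bool" where
  "is_cpower w v c \<longleftrightarrow>
     (if w = 0 then c = 0 else (\<exists>L. exp L = w \<and> c = exp (v * L)))"

text \<open>
  The modified I-Konhauser Mittag-Leffler function with upper parameters \<open>g1, g2, g3\<close> and lower
  parameters \<open>g4, g5, g6; p; q; v\<close>. Its second argument has the form \<open>w * s\<close> with \<open>w\<close> complex and
  \<open>s\<close> a positive real; it is represented by \<open>s\<close> and the chosen value \<open>c\<close> of \<open>w\<close> to the \<open>v\<close>,
  so that the \<open>v * n\<close>-th power of \<open>w * s\<close> is \<open>c ^ n * s powr (v * n)\<close>.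
\<close>

definition konhauser_ML ::
  "complex \<Rightarrow> complex \<Rightarrow> complex \<Rightarrow> complex \<Rightarrow> complex \<Rightarrow> complex \<Rightarrow>
   complex \<Rightarrow> complex \<Rightarrow> complex \<Rightarrow> complex \<Rightarrow> complex \<Rightarrow> real \<Rightarrow> complex" where
  "konhauser_ML g1 g2 g3 g4 g5 g6 p q v z c s =
     (\<Sum>l. \<Sum>n. (-1) ^ l * pochhammer g1 (2 * l) * pochhammer g2 (l + n) * pochhammer g3 l *
                z ^ l * (c ^ n * of_real s powr (v * of_nat n)) /
                (pochhammer g4 l * pochhammer g5 l * pochhammer g6 l *
                 Gamma (p + of_nat l) * Gamma (q + v * of_nat n) * fact n * fact l))"

text \<open>
  The case \<open>g4 = (g1 + 1) / 2\<close>, \<open>g5 = g2\<close>, \<open>g6 = g3\<close>, where the Pochhammer symbols common to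
  numerator and denominator are cancelled before values are substituted. The result is meaningful
  for all complex \<open>g1, g2, g3\<close> and no longer depends on \<open>g3\<close>. Lemma \<open>konhauser_ML_cancel\<close> below
  relates the two functions wherever the uncancelled one has nonzero denominators.
\<close>

definition konhauser_kernel ::
  "complex \<Rightarrow> complex \<Rightarrow> complex \<Rightarrow> complex \<Rightarrow> complex \<Rightarrow> complex \<Rightarrow>
   complex \<Rightarrow> complex \<Rightarrow> real \<Rightarrow> complex" where
  "konhauser_kernel g1 g2 g3 p q v z c s =
     (\<Sum>l. \<Sum>n. (-4) ^ l * pochhammer (g1 / 2) l * pochhammer (g2 + of_nat l) n *
                z ^ l * (c ^ n * of_real s powr (v * of_nat n)) /
                (Gamma (p + of_nat l) * Gamma (q + v * of_nat n) * fact n * fact l))"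

lemma konhauser_ML_cancel:
  assumes "\<And>l. pochhammer ((g1 + 1) / 2) l \<noteq> 0"
    and "\<And>l. pochhammer g2 l \<noteq> 0" and "\<And>l. pochhammer g3 l \<noteq> 0"
  shows "konhauser_ML g1 g2 g3 ((g1 + 1) / 2) g2 g3 p q v z c s =
         konhauser_kernel g1 g2 g3 p q v z c s"
proof -
  have double: "pochhammer g1 (2 * l) =
      4 ^ l * pochhammer (g1 / 2) l * pochhammer ((g1 + 1) / 2) l" for l
    using pochhammer_double[of "g1 / 2" l] by (simp add: power_mult add_divide_distrib)
  have split: "pochhammer g2 (l + n) = pochhammer g2 l * pochhammer (g2 + of_nat l) n" for l n
    by (rule pochhammer_product')
  have sign: "(- 4 :: complex) ^ l = (- 1) ^ l * 4 ^ l" for l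
    by (simp flip: power_mult_distrib)
  show ?thesis
    unfolding konhauser_ML_def konhauser_kernel_def double split sign
    using assms by (simp add: mult.assoc mult.left_commute)
qed

text \<open>
  The argument \<open>c\<close> stands for the chosen value of \<open>w2\<close> to the \<open>v\<close>, see \<open>is_cpower\<close>.
\<close>

definition konhauser_op ::
  "complex \<Rightarrow> complex \<Rightarrow> complex \<Rightarrow> complex \<Rightarrow> complex \<Rightarrow> complex \<Rightarrow>
   complex \<Rightarrow> complex \<Rightarrow> real \<Rightarrow> real \<Rightarrow> (real \<times> real \<Rightarrow> complex) \<Rightarrow> real \<times> real \<Rightarrow> complex" where
  "konhauser_op g1 g2 g3 p q v w1 c a1 b1 d = (\<lambda>(z, t).
     LINT y:{b1<..<t}|lebesgue. LINT x:{a1<..<z}|lebesgue.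
       of_real (t - y) powr (q - 1) * of_real (z - x) powr (p - 1) *
       konhauser_kernel g1 g2 g3 p q v (w1 * of_real (z - x)) c (t - y) * d (x, y))"

definition frac_int2 ::
  "complex \<Rightarrow> complex \<Rightarrow> real \<Rightarrow> real \<Rightarrow> (real \<times> real \<Rightarrow> complex) \<Rightarrow> real \<times> real \<Rightarrow> complex" where
  "frac_int2 \<sigma> \<tau> a1 b1 d = (\<lambda>(z, t).
     1 / (Gamma \<sigma> * Gamma \<tau>) *
     (LINT y:{b1<..<t}|lebesgue. LINT x:{a1<..<z}|lebesgue.
       of_real (z - x) powr (\<sigma> - 1) * of_real (t - y) powr (\<tau> - 1) * d (x, y)))"

end

theory Submission
  imports Defs
begin

text \<open>
  The operators are convolutions on the positive quadrant, so composing two of them amounts to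
  convolving their kernels. Multiplied by \<open>(t - y) powr (q - 1) * (z - x) powr (p - 1)\<close>, the kernel
  function is a double series whose \<open>(l, n)\<close> term is a coefficient times the product of the
  Riemann-Liouville kernel of order \<open>p + l\<close> in one variable and of order \<open>q + v * n\<close> in the other. As
  Riemann-Liouville kernels form a semigroup under convolution (\<open>conv_rl\<close>), convolving two such series
  adds the pairs of orders and multiplies the coefficients like those of power series in two variables
  (\<open>conv_rl_series\<close>). The coefficients here have the generating function
  \<open>(1 - Y) powr (- g2) * (1 + 4 * X / (1 - Y)) powr (- g1 / 2)\<close> with \<open>X\<close> and \<open>Y\<close> scaled by \<open>w1\<close>
  and \<open>c\<close>; it is multiplicative in \<open>(g1, g2)\<close>, so multiplying two coefficient families adds the
  parameters (\<open>cauchy_product2_konhauser_coeff\<close>, proved by two applications of the Vandermonde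
  identity). For \<open>g1 = g2 = 0\<close> only the \<open>(0, 0)\<close> term survives and the operator is a fractional
  integral, which gives the second claim.

  Two points of analysis remain. The series must converge, and well enough to be integrated term by
  term: the coefficients grow at most geometrically, while \<open>1 / Gamma (q + v * n)\<close> decays faster than
  any geometric sequence even for complex \<open>v\<close> (\<open>summable_power_div_Gamma\<close>), so on a bounded
  rectangle the series is dominated by a convergent series of numbers times its leading kernel.
  And since \<open>d\<close> is merely summable, the reordering of integrals holds only almost everywhere. On the
  rectangle the operators see the kernels only on a box of the same side lengths, where they are
  integrable, so the claim follows from associativity of convolution of integrable
  functions (\<open>AE_conv_assoc\<close>), applied to a Borel representative of \<open>d\<close>.
\<close>

section \<open>Convolution on Euclidean space\<close>

interpretation lborel_pair:
  pair_sigma_finite "lborel :: 'a::euclidean_space measure" "lborel :: 'b::euclidean_space measure"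
  ..

lemma lborel_shift:
  fixes f :: "'a::euclidean_space \<Rightarrow> complex"
  assumes [measurable]: "f \<in> borel_measurable borel"
  shows integrable_lborel_shift: "integrable lborel (\<lambda>x. f (x - c)) \<longleftrightarrow> integrable lborel f"
    and integral_lborel_shift: "(LINT x|lborel. f (x - c)) = (LINT x|lborel. f x)"
proof -
  have "integrable (distr lborel borel ((+) (- c))) f \<longleftrightarrow> integrable lborel (\<lambda>x. f (- c + x))"
    by (rule integrable_distr_eq) auto
  then show "integrable lborel (\<lambda>x. f (x - c)) \<longleftrightarrow> integrable lborel f"
    unfolding lborel_distr_plus by simp
  have "integral\<^sup>L (distr lborel borel ((+) (- c))) f = (LINT x|lborel. f (- c + x))"
    by (rule integral_distr) auto
  then show "(LINT x|lborel. f (x - c)) = (LINT x|lborel. f x)"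
    unfolding lborel_distr_plus by simp
qed

definition conv :: "('a::euclidean_space \<Rightarrow> complex) \<Rightarrow> ('a \<Rightarrow> complex) \<Rightarrow> 'a \<Rightarrow> complex" where
  "conv f g u = (LINT v|lborel. f (u - v) * g v)"

lemma borel_measurable_conv [measurable]:
  assumes [measurable]: "f \<in> borel_measurable borel" "g \<in> borel_measurable borel"
  shows "conv f g \<in> borel_measurable borel"
  unfolding conv_def by measurable

lemma integrable_conv_pair:
  fixes f g :: "'a::euclidean_space \<Rightarrow> complex"
  assumes f: "integrable lborel f" and g: "integrable lborel g"
  shows "integrable (lborel \<Otimes>\<^sub>M lborel) (\<lambda>(v, u). f (u - v) * g v)"
proof (rule lborel_pair.Fubini_integrable)
  have [measurable]: "f \<in> borel_measurable borel" "g \<in> borel_measurable borel"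
    using f g by auto
  show "(\<lambda>(v, u). f (u - v) * g v) \<in> borel_measurable (lborel \<Otimes>\<^sub>M lborel)"
    by measurable
  have "(LINT u|lborel. norm (f (u - v) * g v)) = (LINT u|lborel. norm (f u)) * norm (g v)" for v
  proof -
    have "complex_of_real (LINT u|lborel. norm (f (u - v))) = of_real (LINT u|lborel. norm (f u))"
      using integral_lborel_shift[of "\<lambda>u. of_real (norm (f u))" v] by simp
    then show ?thesis
      by (simp add: norm_mult)
  qed
  with g show "integrable lborel (\<lambda>v. LINT u|lborel. norm (case (v, u) of (v, u) \<Rightarrow> f (u - v) *
      g v))"
    by simp
  have "integrable lborel (\<lambda>u. f (u - v) * g v)" for v
    using integrable_lborel_shift[of f v] f by simp
  then show "AE v in lborel. integrable lborel (\<lambda>u. case (v, u) of (v, u) \<Rightarrow> f (u - v) * g v)"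
    by simp
qed

lemma
  assumes f: "integrable lborel f" and g: "integrable lborel g"
  shows AE_integrable_conv: "AE u in lborel. integrable lborel (\<lambda>v. f (u - v) * g v)"
    and integrable_conv: "integrable lborel (conv f g)"
    and integral_conv: "(LINT u|lborel. conv f g u) = (LINT u|lborel. f u) * (LINT v|lborel. g v)"
proof -
  have int: "integrable (lborel \<Otimes>\<^sub>M lborel) (case_prod (\<lambda>v u. f (u - v) * g v))"
    using integrable_conv_pair[OF assms] by simp
  show "AE u in lborel. integrable lborel (\<lambda>v. f (u - v) * g v)"
    using lborel_pair.AE_integrable_snd[OF int] .
  show "integrable lborel (conv f g)"
    using lborel_pair.integrable_snd[OF int] by (simp add: conv_def [abs_def])
  have "(LINT u|lborel. conv f g u) = (LINT v|lborel. LINT u|lborel. f (u - v) * g v)"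
    unfolding conv_def using lborel_pair.Fubini_integral[OF int] .
  also have "\<dots> = (LINT u|lborel. f u) * (LINT v|lborel. g v)"
    using f integral_lborel_shift[of f] by simp
  finally show "(LINT u|lborel. conv f g u) = (LINT u|lborel. f u) * (LINT v|lborel. g v)" .
qed

text \<open>
  Tonelli applied to the absolute values: the iterated convolution of \<open>norm \<circ> f\<close>, \<open>norm \<circ> g\<close> and
  \<open>norm \<circ> h\<close> is finite almost everywhere, and at each such point Fubini allows the exchange.
\<close>

lemma AE_conv_assoc:
  assumes f: "integrable lborel f" and g: "integrable lborel g" and h: "integrable lborel h"
  shows "AE u in lborel. conv f (conv g h) u = conv (conv f g) h u"
proof -
  have [measurable]: "f \<in> borel_measurable borel" "g \<in> borel_measurable borel"
    "h \<in> borel_measurable borel"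
    using assms by auto
  define n where "n k x = complex_of_real (norm (k x))" for k :: "'a \<Rightarrow> complex" and x
  have n: "integrable lborel (n k)" if "integrable lborel k" for k
    using that unfolding n_def by simp
  note gh = AE_integrable_conv[OF g h]
  have "integrable lborel (conv (n g) (n h))"
    by (intro integrable_conv n g h)
  then have "AE u in lborel. integrable lborel (\<lambda>v. n f (u - v) * conv (n g) (n h) v)"
    by (intro AE_integrable_conv n f)
  then show ?thesis
  proof eventually_elim
    case (elim u)
    let ?F = "\<lambda>v w. f (u - v) * (g (v - w) * h w)"
    have int: "integrable (lborel \<Otimes>\<^sub>M lborel) (case_prod ?F)"
    proof (rule lborel_pair.Fubini_integrable)
      show "case_prod ?F \<in> borel_measurable (lborel \<Otimes>\<^sub>M lborel)"
        by measurable
      have eq: "(LINT w|lborel. norm (?F v w)) = norm (n f (u - v) * conv (n g) (n h) v)" for v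
      proof -
        have "conv (n g) (n h) v = of_real (LINT w|lborel. norm (g (v - w)) * norm (h w))"
          unfolding conv_def n_def by (simp flip: of_real_mult)
        then show ?thesis
          by (simp add: n_def norm_mult integral_nonneg_AE)
      qed
      show "integrable lborel (\<lambda>v. LINT w|lborel. norm (case (v, w) of (v, w) \<Rightarrow> ?F v w))"
        using integrable_norm[OF elim] by (simp add: eq)
      show "AE v in lborel. integrable lborel (\<lambda>w. case (v, w) of (v, w) \<Rightarrow> ?F v w)"
        using gh by eventually_elim simp
    qed
    have "conv f (conv g h) u = (LINT v|lborel. LINT w|lborel. ?F v w)"
      unfolding conv_def by simp
    also have "\<dots> = (LINT w|lborel. LINT v|lborel. ?F v w)"
      using lborel_pair.Fubini_integral[OF int] by simp
    also have "\<dots> = (LINT w|lborel. conv f g (u - w) * h w)"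
    proof (rule Bochner_Integration.integral_cong)
      fix w
      have "(LINT v|lborel. ?F v w) = (LINT v|lborel. (f (u - w - (v - w)) * g (v - w)) * h w)"
        by (simp add: mult.assoc)
      also have "\<dots> = (LINT v|lborel. f (u - w - (v - w)) * g (v - w)) * h w"
        by simp
      also have "(LINT v|lborel. f (u - w - (v - w)) * g (v - w)) = conv f g (u - w)"
        unfolding conv_def by (rule integral_lborel_shift) measurable
      finally show "(LINT v|lborel. ?F v w) = conv f g (u - w) * h w" .
    qed simp
    finally show ?case
      unfolding conv_def[of "conv f g"] .
  qed
qed

section \<open>Riemann-Liouville kernels and the growth of the Gamma function\<close>

lemma integrable_cmult_iff:
  fixes c :: complex
  assumes "c \<noteq> 0"
  shows "integrable M (\<lambda>x. c * f x) \<longleftrightarrow> integrable M f"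
proof
  assume "integrable M (\<lambda>x. c * f x)"
  then have "integrable M (\<lambda>x. inverse c * (c * f x))"
    by (rule integrable_mult_right)
  then show "integrable M f"
    using assms by (simp flip: mult.assoc)
qed simp

text \<open>
  The kernel of the fractional integral of order \<open>a\<close>. Being zero off the positive axis, it turns
  integrals over \<open>{0<..<u}\<close> into plain convolutions.
\<close>

definition rl_kernel :: "complex \<Rightarrow> real \<Rightarrow> complex" where
  "rl_kernel a x = (if x > 0 then of_real x powr (a - 1) / Gamma a else 0)"

lemma rl_kernel_nonpos [simp]: "x \<le> 0 \<Longrightarrow> rl_kernel a x = 0"
  by (simp add: rl_kernel_def)

lemma borel_measurable_rl_kernel [measurable]: "rl_kernel a \<in> borel_measurable borel"
proof -
  have "rl_kernel a = (\<lambda>x. if x > 0 then exp ((a - 1) * of_real (ln x)) / Gamma a else 0)"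
    by (auto simp: rl_kernel_def powr_def Ln_of_real)
  also have "\<dots> \<in> borel_measurable borel"
    by measurable
  finally show ?thesis .
qed

lemma norm_rl_kernel: "norm (rl_kernel a x) =
    (if x > 0 then x powr (Re a - 1) / norm (Gamma a) else 0)"
  by (simp add: rl_kernel_def norm_divide norm_powr_real_powr)

lemma rl_kernel_scale:
  assumes "u > 0"
  shows "rl_kernel a (u * x) = of_real u powr (a - 1) * rl_kernel a x"
  using assms by (auto simp: rl_kernel_def zero_less_mult_iff powr_times_real)

lemma rl_exp:
  assumes a: "Re a > 0"
  shows integrable_rl_exp: "integrable lborel (\<lambda>x. rl_kernel a x * of_real (exp (- x)))"
    and integral_rl_exp: "(LINT x|lborel. rl_kernel a x * of_real (exp (- x))) = 1"
proof -
  let ?f = "\<lambda>x. rl_kernel a x * of_real (exp (- x))"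
  let ?g = "\<lambda>t. complex_of_real t powr (a - 1) / of_real (exp t)"
  have "Gamma a \<noteq> 0"
    using a by (auto simp: Gamma_eq_zero_iff elim!: nonpos_Ints_cases)
  then have ind: "Gamma a * ?f x = indicator {0<..} x *\<^sub>R ?g x" for x
    by (auto simp: rl_kernel_def exp_minus field_simps indicator_def)
  have abs: "?g absolutely_integrable_on {0<..}"
    by (rule absolutely_integrable_Gamma_integral'[OF a])
  then have "integrable lebesgue (\<lambda>x. Gamma a * ?f x)"
    unfolding ind set_integrable_def .
  then have *: "integrable lebesgue ?f"
    by (simp only: integrable_cmult_iff[OF \<open>Gamma a \<noteq> 0\<close>])
  have meas: "?f \<in> borel_measurable lborel"
    by measurable
  show "integrable lborel ?f"
    using * integrable_completion[OF meas] by simp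
  have "Gamma a * (LINT x|lebesgue. ?f x) = (LINT x:{0<..}|lebesgue. ?g x)"
    unfolding set_lebesgue_integral_def ind[symmetric] by simp
  also have "\<dots> = integral {0<..} ?g"
    by (rule set_lebesgue_integral_eq_integral[OF abs])
  also have "\<dots> = Gamma a"
    using Gamma_integral_complex'[OF a] by (rule integral_unique)
  finally show "(LINT x|lborel. ?f x) = 1"
    using \<open>Gamma a \<noteq> 0\<close> integral_completion[OF meas] by simp
qed

lemma rl_conv_scale:
  assumes "u > 0"
  shows "rl_kernel a (u - u * s) * rl_kernel b (u * s) =
    of_real u powr (a - 1) * of_real u powr (b - 1) * (rl_kernel a (1 - s) * rl_kernel b s)"
  using rl_kernel_scale[OF assms, of a "1 - s"] rl_kernel_scale[OF assms, of b s]
  by (simp add: right_diff_distrib mult_ac)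

lemma AE_lborel_obtain_pos:
  assumes "AE u in lborel. P (u::real)"
  obtains u where "u > 0" "P u"
proof -
  have "\<exists>u>0. P u"
  proof (rule ccontr)
    assume *: "\<not> (\<exists>u>0. P u)"
    have "AE u in lborel. u \<notin> {0<..<1::real}"
      using assms by eventually_elim (use * in auto)
    then have "{0<..<1::real} \<in> null_sets lborel"
      by (simp add: AE_iff_null_sets)
    then show False
      by (auto simp: null_sets_def)
  qed
  with that show thesis by blast
qed

text \<open>
  The semigroup law, equivalent to the complex Beta integral. By scaling, the convolution is
  \<open>\<kappa> * rl_kernel (a + b)\<close> for some constant \<open>\<kappa>\<close>; multiplying the kernels by \<open>exp (- x)\<close> makes each of
  them have integral 1 and commutes with convolution, so comparing total integrals gives \<open>\<kappa> = 1\<close>.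
  Scaling also upgrades integrability of the integrand from almost every \<open>u\<close> to every \<open>u\<close>.
\<close>

lemma
  assumes a: "Re a > 0" and b: "Re b > 0"
  shows integrable_rl_conv: "integrable lborel (\<lambda>v. rl_kernel a (u - v) * rl_kernel b v)"
    and conv_rl: "conv (rl_kernel a) (rl_kernel b) u = rl_kernel (a + b) u"
proof -
  define f where "f u v = rl_kernel a (u - v) * rl_kernel b v" for u v
  define e where "e a x = rl_kernel a x * of_real (exp (- x))" for a x
  have [measurable]: "f u \<in> borel_measurable borel" for u
    unfolding f_def by measurable
  have ef: "e a (u - v) * e b v = of_real (exp (- u)) * f u v" for u v
    unfolding e_def f_def by (simp add: exp_minus exp_diff field_simps)
  have int_e: "integrable lborel (e a)" "integrable lborel (e b)"
    unfolding e_def using integrable_rl_exp a b by auto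
  have scale: "f u (0 + u * s) = of_real u powr (a - 1) * of_real u powr (b - 1) * f 1 s"
    if "u > 0" for u s
    unfolding f_def using rl_conv_scale[OF that] by simp
  have int_scale: "integrable lborel (f u) \<longleftrightarrow> integrable lborel (f 1)" if "u > 0" for u
  proof -
    have "integrable lborel (f u) \<longleftrightarrow> integrable lborel (\<lambda>s. f u (0 + u * s))"
      using that by (subst lborel_integrable_real_affine_iff) auto
    also have "\<dots> \<longleftrightarrow> integrable lborel (f 1)"
      using that by (subst scale) (auto simp: integrable_cmult_iff)
    finally show ?thesis .
  qed
  have "AE u in lborel. integrable lborel (f u)"
    using AE_integrable_conv[OF int_e] by (simp add: ef integrable_cmult_iff)
  then obtain u0 where "u0 > 0" "integrable lborel (f u0)"
    by (rule AE_lborel_obtain_pos)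
  then have int: "integrable lborel (f u)" if "u > 0" for u
    using int_scale that by blast
  have zero: "f u = (\<lambda>v. 0)" if "u \<le> 0" for u
    using that by (auto simp: f_def fun_eq_iff rl_kernel_def)
  show "integrable lborel (\<lambda>v. rl_kernel a (u - v) * rl_kernel b v)"
    using int[of u] zero[of u] unfolding f_def[symmetric] by (cases "u > 0") auto
  define \<kappa> where "\<kappa> = Gamma (a + b) * (LINT s|lborel. f 1 s)"
  have nz: "Gamma (a + b) \<noteq> 0"
    using a b by (auto simp: Gamma_eq_zero_iff elim!: nonpos_Ints_cases dest!: arg_cong[where f = Re])
  have val: "(LINT v|lborel. f u v) = \<kappa> * rl_kernel (a + b) u" for u
  proof (cases "u > 0")
    case True
    have "(LINT v|lborel. f u v) = \<bar>u\<bar> *\<^sub>R (LINT s|lborel. f u (0 + u * s))"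
      using True by (intro lborel_integral_real_affine) auto
    also have "\<dots> = of_real u * of_real u powr (a - 1) * of_real u powr (b - 1) *
        (LINT s|lborel. f 1 s)"
      using True by (simp only: scale integral_mult_right_zero) (simp add: scaleR_conv_of_real)
    also have "of_real u * of_real u powr (a - 1) * of_real u powr (b - 1) =
        complex_of_real u powr (a + b - 1)"
      using True by (simp add: powr_diff powr_add)
    finally show ?thesis
      using True nz by (simp add: rl_kernel_def \<kappa>_def)
  qed (simp add: zero)
  have "conv (e a) (e b) u = \<kappa> * e (a + b) u" for u
    unfolding conv_def ef using val[of u] by (simp add: e_def)
  then have "\<kappa> * (LINT u|lborel. e (a + b) u) = (LINT u|lborel. e a u) * (LINT u|lborel. e b u)"
    using integral_conv[OF int_e] by simp
  then have "\<kappa> = 1"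
    using a b by (simp add: e_def integral_rl_exp)
  then show "conv (rl_kernel a) (rl_kernel b) u = rl_kernel (a + b) u"
    unfolding conv_def using val[of u] by (simp add: f_def)
qed

text \<open>
  The \<open>L\<^sup>1\<close> norm of \<open>rl_kernel a x * exp (- x)\<close>, hence submultiplicative. It measures how much
  smaller \<open>norm (Gamma a)\<close> is than \<open>Gamma (Re a)\<close>.
\<close>

definition Gamma_ratio :: "complex \<Rightarrow> real" where
  "Gamma_ratio a = Gamma (Re a) / norm (Gamma a)"

lemma Gamma_nonzero_Re_pos: "Re a > 0 \<Longrightarrow> Gamma a \<noteq> 0"
  by (auto simp: Gamma_eq_zero_iff elim!: nonpos_Ints_cases)

lemma norm_rl_kernel_eq_Gamma_ratio:
  assumes "Re a > 0"
  shows "of_real (norm (rl_kernel a x)) = of_real (Gamma_ratio a) * rl_kernel (of_real (Re a)) x"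
proof (cases "x > 0")
  case True
  have "complex_of_real x powr (of_real (Re a) - 1) = of_real (x powr (Re a - 1))"
    using True powr_of_real[of x "Re a - 1"] by simp
  then show ?thesis
    using Gamma_real_pos[OF assms] True
    unfolding norm_rl_kernel by (simp add: rl_kernel_def Gamma_ratio_def Gamma_complex_of_real)
qed (simp add: norm_rl_kernel)

text \<open>
  Take norms under the integral in the semigroup law at the point 1.
\<close>

lemma Gamma_ratio_add:
  assumes a: "Re a > 0" and b: "Re b > 0"
  shows "Gamma_ratio (a + b) \<le> Gamma_ratio a * Gamma_ratio b"
proof -
  define x where "x = (LINT v|lborel. norm (rl_kernel a (1 - v)) * norm (rl_kernel b v))"
  have G: "Gamma (Re a + Re b) > 0"
    using a b by (intro Gamma_real_pos) auto
  have "Gamma_ratio (a + b) / Gamma (Re a + Re b) = norm (conv (rl_kernel a) (rl_kernel b) 1)"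
    using less_imp_neq[OF G] a b by (simp add: conv_rl norm_rl_kernel Gamma_ratio_def)
  also have "\<dots> \<le> x"
    unfolding conv_def x_def norm_mult[symmetric] by (rule integral_norm_bound)
  finally have le: "Gamma_ratio (a + b) \<le> Gamma (Re a + Re b) * x"
    using G by (simp add: field_simps)
  have "complex_of_real x =
      (LINT v|lborel. of_real (norm (rl_kernel a (1 - v))) * of_real (norm (rl_kernel b v)))"
    unfolding x_def integral_complex_of_real[symmetric] of_real_mult ..
  also have "\<dots> = of_real (Gamma_ratio a * Gamma_ratio b) *
      conv (rl_kernel (of_real (Re a))) (rl_kernel (of_real (Re b))) 1"
    unfolding conv_def norm_rl_kernel_eq_Gamma_ratio[OF a] norm_rl_kernel_eq_Gamma_ratio[OF b]
    by (subst integral_mult_right_zero [symmetric]) (simp add: mult_ac)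
  also have "\<dots> = of_real (Gamma_ratio a * Gamma_ratio b / Gamma (Re a + Re b))"
    using a b by (simp add: conv_rl rl_kernel_def Gamma_complex_of_real flip: of_real_add)
  finally have "x = Gamma_ratio a * Gamma_ratio b / Gamma (Re a + Re b)"
    unfolding of_real_eq_iff .
  with le G show ?thesis
    by simp
qed

text \<open>
  Only the part of Euler's integral over \<open>{T..T+1}\<close> is kept. With \<open>T\<close> arbitrary this beats
  every geometric sequence.
\<close>

lemma Gamma_real_ge:
  assumes "T \<ge> 0" "y \<ge> 1"
  shows "T powr (y - 1) * exp (- (T + 1)) \<le> Gamma (y :: real)"
proof -
  have int: "((\<lambda>t. t powr (y - 1) / exp t) has_integral Gamma y) {0..}"
    using assms by (intro Gamma_integral_real) auto
  have int': "((\<lambda>t. t powr (y - 1) / exp t) integrable_on {T..T+1})"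
    using assms by (intro integrable_on_subinterval[OF has_integral_integrable[OF int]]) auto
  have "T powr (y - 1) * exp (- (T + 1)) = integral {T..T+1} (\<lambda>t. T powr (y - 1) * exp (- (T + 1)))"
    by simp
  also have "\<dots> \<le> integral {T..T+1} (\<lambda>t. t powr (y - 1) / exp t)"
  proof (rule integral_le[OF _ int'])
    show "T powr (y - 1) * exp (- (T + 1)) \<le> t powr (y - 1) / exp t" if "t \<in> {T..T+1}" for t
      using that assms
      by (auto simp: divide_inverse simp flip: exp_minus intro!: mult_mono powr_mono2)
  qed auto
  also have "\<dots> \<le> Gamma y"
    using assms by (intro has_integral_subset_le[OF _ integrable_integral[OF int'] int]) auto
  finally show ?thesis .
qed

text \<open>
  Submultiplicativity of \<open>Gamma_ratio\<close> costs a geometric factor \<open>K ^ n\<close> when \<open>Gamma\<close> is replaced by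
  its value at the real part; there \<open>Gamma_real_ge\<close> applies, with \<open>T\<close> so large that
  \<open>T powr Re v\<close> exceeds \<open>2 * R * K\<close>.
\<close>

lemma summable_power_div_Gamma:
  assumes q: "Re q > 0" and v: "Re v > 0" and R: "R \<ge> 0"
  shows "summable (\<lambda>n. R ^ n / norm (Gamma (q + v * of_nat n)))"
proof -
  define K where "K = Gamma_ratio v"
  have K: "K > 0"
    using Gamma_real_pos[OF v] Gamma_nonzero_Re_pos[OF v] by (simp add: K_def Gamma_ratio_def)
  have ratio: "Gamma_ratio (q + v * of_nat n) \<le> Gamma_ratio q * K ^ n" for n
  proof (induction n)
    case (Suc n)
    have "Gamma_ratio (q + v * of_nat n + v) \<le> Gamma_ratio (q + v * of_nat n) * K"
      unfolding K_def using q v by (intro Gamma_ratio_add) (auto intro!: add_pos_nonneg)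
    also have "\<dots> \<le> Gamma_ratio q * K ^ n * K"
      using Suc K by (intro mult_right_mono) auto
    finally show ?case by (simp add: algebra_simps)
  qed simp
  \<comment> \<open>Adding 1 keeps \<open>T \<ge> 1\<close> and makes the ratio of the comparison series less than 1/2.\<close>
  define T where "T = (2 * R * K + 1) powr (1 / Re v)"
  have T: "T powr Re v = 2 * R * K + 1" "T \<ge> 1"
    using v R K by (auto simp: T_def powr_powr ge_one_powr_ge_zero add_nonneg_nonneg)
  define C where "C = Gamma_ratio q * exp (T + 1) / T powr (Re q - 1)"
  have "eventually (\<lambda>n. real n > (1 - Re q) / Re v) sequentially"
    using filterlim_at_top_dense filterlim_real_sequentially by blast
  then have "eventually (\<lambda>n. norm (R ^ n / norm (Gamma (q + v * of_nat n))) \<le>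
      C * (R * K / (2 * R * K + 1)) ^ n) sequentially"
  proof eventually_elim
    case (elim n)
    let ?z = "q + v * of_nat n"
    have ge1: "Re ?z \<ge> 1"
      using elim v by (simp add: field_simps)
    have "T powr (Re ?z - 1) * exp (- (T + 1)) \<le> Gamma (Re ?z)"
      using T ge1 by (intro Gamma_real_ge) auto
    moreover have "T powr (Re ?z - 1) = T powr (Re q - 1) * (T powr Re v) ^ n"
    proof -
      have "T powr (Re q - 1) * (T powr Re v) ^ n = T powr (Re q - 1) * T powr (Re v * real n)"
        using T(2) by (simp add: powr_powr flip: powr_realpow)
      also have "\<dots> = T powr (Re q - 1 + Re v * real n)"
        by (simp only: powr_add)
      finally show ?thesis by (simp add: algebra_simps)
    qed
    ultimately have lower: "T powr (Re q - 1) * (2 * R * K + 1) ^ n / exp (T + 1) \<le> Gamma (Re ?z)"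
      unfolding T(1) divide_inverse exp_minus by simp
    have pos: "T powr (Re q - 1) * (2 * R * K + 1) ^ n / exp (T + 1) > 0"
      using T R K by (auto intro!: divide_pos_pos mult_pos_pos zero_less_power add_nonneg_pos)
    have "1 / norm (Gamma ?z) = Gamma_ratio ?z / Gamma (Re ?z)"
      using less_imp_neq[OF Gamma_real_pos[of "Re ?z"]] ge1 by (simp add: Gamma_ratio_def)
    also have "\<dots> \<le>
        (Gamma_ratio q * K ^ n) / (T powr (Re q - 1) * (2 * R * K + 1) ^ n / exp (T + 1))"
      using ratio[of n] lower pos q K Gamma_real_pos[OF q]
      by (intro frac_le) (auto simp: Gamma_ratio_def)
    also have "\<dots> = C * (K / (2 * R * K + 1)) ^ n"
      by (simp add: C_def power_divide)
    finally have "R ^ n * (1 / norm (Gamma ?z)) \<le> R ^ n * (C * (K / (2 * R * K + 1)) ^ n)"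
      using R by (intro mult_left_mono) auto
    then show ?case
      using R by (simp add: power_divide power_mult_distrib mult_ac)
  qed
  moreover have "summable (\<lambda>n. C * (R * K / (2 * R * K + 1)) ^ n)"
  proof (intro summable_mult summable_geometric)
    have "norm (r / (2 * r + 1)) < 1" if "r \<ge> 0" for r :: real
      using that by simp
    from this[of "R * K"] show "norm (R * K / (2 * R * K + 1)) < 1"
      using R K by (simp add: mult.assoc)
  qed
  ultimately show ?thesis
    by (rule summable_comparison_test_ev)
qed

section \<open>Double series of Riemann-Liouville kernels\<close>

text \<open>
  The index type is enumerated to reduce to series over the natural numbers. Here it will be
  \<open>(nat \<times> nat) \<times> (nat \<times> nat)\<close>, so that a product of two double series is integrated in one step.
\<close>

lemma has_sum_integral_dominated:
  fixes f :: "'i::countable \<Rightarrow> 'a \<Rightarrow> complex"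
  assumes inf: "infinite (UNIV :: 'i set)"
    and meas [measurable]: "\<And>i. f i \<in> borel_measurable M"
    and bound: "\<And>i x. norm (f i x) \<le> m i * F x"
    and m: "m summable_on UNIV" and F: "integrable M F"
  shows "((\<lambda>i. LINT x|M. f i x) has_sum (LINT x|M. (\<Sum>\<^sub>\<infinity>i. f i x))) UNIV"
proof -
  obtain e :: "nat \<Rightarrow> 'i" where e: "bij_betw e UNIV UNIV"
    using inf by (metis bij_betw_from_nat_into countableI_type)
  have int: "integrable M (f i)" for i
    by (rule Bochner_Integration.integrable_bound[of _ "\<lambda>x. m i * F x"])
      (use F bound in \<open>auto intro: order_trans[OF _ abs_ge_self]\<close>)
  have "(\<lambda>k. m (e k)) summable_on UNIV"
    using m by (simp add: summable_on_reindex_bij_betw[OF e])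
  then have me: "summable (\<lambda>k. m (e k))"
    by (rule summable_on_imp_summable)
  have sum_norm: "summable (\<lambda>k. norm (f (e k) x))" for x
    by (rule summable_comparison_test'[OF summable_mult2[OF me, of "F x"], of 0]) (use bound in auto)
  have infsum: "(\<Sum>\<^sub>\<infinity>i. f i x) = (\<Sum>k. f (e k) x)" for x
  proof -
    have "((\<lambda>k. f (e k) x) has_sum (\<Sum>k. f (e k) x)) UNIV"
      using sum_norm[of x] by (intro norm_summable_imp_has_sum) (auto dest: summable_norm_cancel)
    then show ?thesis
      by (simp add: has_sum_reindex_bij_betw[OF e, of "\<lambda>i. f i x"] infsumI)
  qed
  have sum_int: "summable (\<lambda>k. LINT x|M. norm (f (e k) x))"
  proof (rule summable_comparison_test'[OF summable_mult2[OF me, of "LINT x|M. F x"], of 0])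
    fix k
    have "(LINT x|M. norm (f (e k) x)) \<le> (LINT x|M. m (e k) * F x)"
      using int F bound by (intro integral_mono) auto
    then show "norm (LINT x|M. norm (f (e k) x)) \<le> m (e k) * (LINT x|M. F x)"
      by simp
  qed
  have "(LINT x|M. (\<Sum>k. f (e k) x)) = (\<Sum>k. LINT x|M. f (e k) x)"
    using sum_norm sum_int int by (intro integral_suminf) auto
  moreover have "summable (\<lambda>k. norm (LINT x|M. f (e k) x))"
    by (rule summable_comparison_test'[OF sum_int, of 0]) (simp add: integral_norm_bound)
  ultimately have "((\<lambda>k. LINT x|M. f (e k) x) has_sum (LINT x|M. (\<Sum>k. f (e k) x))) UNIV"
    by (intro norm_summable_imp_has_sum) (auto dest: summable_norm_cancel)
  then show ?thesis
    by (simp add: infsum has_sum_reindex_bij_betw[OF e, of "\<lambda>i. LINT x|M. f i x"])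
qed

lemma summable_on_mult_pair:
  fixes f :: "'a \<Rightarrow> real" and g :: "'b \<Rightarrow> real"
  assumes "f summable_on A" "g summable_on B"
    and "\<And>x. x \<in> A \<Longrightarrow> f x \<ge> 0" "\<And>y. y \<in> B \<Longrightarrow> g y \<ge> 0"
  shows "(\<lambda>(x, y). f x * g y) summable_on A \<times> B"
proof (rule summable_on_SigmaI)
  show "((\<lambda>y. case (x, y) of (x, y) \<Rightarrow> f x * g y) has_sum f x * infsum g B) B" for x
    using assms(2) by (auto intro: has_sum_cmult_right has_sum_infsum)
  show "(\<lambda>x. f x * infsum g B) summable_on A"
    using assms(1) by (rule summable_on_cmult_left)
qed (use assms in auto)

lemma suminf_suminf_eq_infsum:
  fixes f :: "nat \<times> nat \<Rightarrow> complex"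
  assumes "f summable_on UNIV"
  shows "(\<Sum>l. \<Sum>n. f (l, n)) = (\<Sum>\<^sub>\<infinity>i. f i)"
proof -
  have f: "f summable_on Sigma UNIV (\<lambda>_. UNIV)"
    using assms by simp
  have inner: "(\<lambda>n. f (l, n)) summable_on UNIV" for l
    using summable_on_SigmaD1[of "\<lambda>l n. f (l, n)" UNIV "\<lambda>_. UNIV" l] f by simp
  have suminf: "suminf h = infsum h UNIV" if "h summable_on UNIV" for h :: "nat \<Rightarrow> complex"
    using that has_sum_imp_sums has_sum_infsum sums_unique by metis
  have "(\<lambda>l. \<Sum>\<^sub>\<infinity>n. f (l, n)) summable_on UNIV"
    using summable_on_Sigma_banach[of "\<lambda>l n. f (l, n)" UNIV "\<lambda>_. UNIV"] f by simp
  then have "(\<Sum>l. \<Sum>n. f (l, n)) = (\<Sum>\<^sub>\<infinity>l. \<Sum>\<^sub>\<infinity>n. f (l, n))"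
    by (simp add: suminf inner)
  also have "\<dots> = infsum f UNIV"
    using infsum_Sigma_banach[OF f] by simp
  finally show ?thesis .
qed

definition rl_term ::
  "(nat \<times> nat \<Rightarrow> complex) \<Rightarrow> complex \<Rightarrow> complex \<Rightarrow> complex \<Rightarrow> nat \<times> nat \<Rightarrow> real \<times> real \<Rightarrow> complex" where
  "rl_term a p q v =
      (\<lambda>(l, n) (x, y). a (l, n) * (rl_kernel (p + of_nat l) x * rl_kernel (q + v * of_nat n) y))"

definition rl_series ::
  "(nat \<times> nat \<Rightarrow> complex) \<Rightarrow> complex \<Rightarrow> complex \<Rightarrow> complex \<Rightarrow> real \<times> real \<Rightarrow> complex" where
  "rl_series a p q v z = (\<Sum>\<^sub>\<infinity>i. rl_term a p q v i z)"

definition geom_bounded :: "(nat \<times> nat \<Rightarrow> complex) \<Rightarrow> bool" where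
  "geom_bounded a \<longleftrightarrow> (\<exists>C X Y. C \<ge> 0 \<and> X \<ge> 0 \<and> Y \<ge> 0 \<and> (\<forall>l n. norm (a (l, n)) \<le> C * X ^ l * Y ^ n))"

text \<open>
  Raising the order by \<open>s\<close> multiplies the kernel by \<open>x powr s\<close>, up to Gamma factors; so all terms
  of the series are bounded by multiples of the leading kernel.
\<close>

lemma norm_rl_kernel_add_le:
  assumes "Re p > 0" "Re s \<ge> 0" "x \<le> A"
  shows "norm (rl_kernel (p + s) x) \<le>
      norm (rl_kernel p x) * (norm (Gamma p) * A powr Re s / norm (Gamma (p + s)))"
proof (cases "x > 0")
  case True
  have "norm (rl_kernel (p + s) x) =
      norm (rl_kernel p x) * (norm (Gamma p) * x powr Re s / norm (Gamma (p + s)))"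
    using True Gamma_nonzero_Re_pos[OF assms(1)] by (simp add: norm_rl_kernel powr_add powr_diff)
  also have "\<dots> \<le> norm (rl_kernel p x) * (norm (Gamma p) * A powr Re s / norm (Gamma (p + s)))"
    using True assms by (intro mult_left_mono divide_right_mono powr_mono2) auto
  finally show ?thesis .
qed simp

lemma borel_measurable_rl_term [measurable]: "rl_term a p q v i \<in> borel_measurable borel"
proof -
  obtain l n where "i = (l, n)"
    by fastforce
  then have "rl_term a p q v i =
      (\<lambda>z. a (l, n) * (rl_kernel (p + of_nat l) (fst z) * rl_kernel (q + v * of_nat n) (snd z)))"
    by (auto simp: rl_term_def)
  also have "\<dots> \<in> borel_measurable borel"
    by (simp only: borel_prod[symmetric]) measurable
  finally show ?thesis .
qed

text \<open>
  The majorant separates the index from the variables, which is what both integrability of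
  the series and termwise integration of products need.
\<close>

lemma rl_term_majorant:
  assumes a: "geom_bounded a" and p: "Re p > 0" and q: "Re q > 0" and v: "Re v > 0"
  obtains m :: "nat \<times> nat \<Rightarrow> real" where "m summable_on UNIV" "\<And>i. m i \<ge> 0"
    "\<And>i x y. x \<le> A \<Longrightarrow> y \<le> B \<Longrightarrow>
      norm (rl_term a p q v i (x, y)) \<le> m i * (norm (rl_kernel p x) * norm (rl_kernel q y))"
proof -
  obtain C X Y where CXY: "C \<ge> 0" "X \<ge> 0" "Y \<ge> 0" "\<And>l n. norm (a (l, n)) \<le> C * X ^ l * Y ^ n"
    using a unfolding geom_bounded_def by blast
  define D where "D = C * norm (Gamma p) * norm (Gamma q)"
  \<comment> \<open>Enlarging the bounds is harmless; a positive base turns \<open>powr\<close> into natural powers.\<close>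
  define A' where "A' = max 1 A"
  define B' where "B' = max 1 B"
  define f where "f l = (X * A') ^ l / norm (Gamma (p + of_nat l))" for l
  define g where "g n = (Y * B' powr Re v) ^ n / norm (Gamma (q + v * of_nat n))" for n
  define m where "m = (\<lambda>(l, n). D * (f l * g n))"
  have pos: "A' > 0" "B' > 0"
    by (auto simp: A'_def B'_def)
  have nonneg: "f l \<ge> 0" "g n \<ge> 0" for l n
    using CXY pos by (auto simp: f_def g_def intro!: divide_nonneg_nonneg mult_nonneg_nonneg)
  have D: "D \<ge> 0"
    using CXY by (simp add: D_def)
  have "summable f"
    using summable_power_div_Gamma[OF p, of 1 "X * A'"] CXY pos by (simp add: f_def [abs_def])
  moreover have "summable g"
    using summable_power_div_Gamma[OF q v, of "Y * B' powr Re v"] CXY by (simp add: g_def [abs_def])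
  ultimately have "f summable_on UNIV" "g summable_on UNIV"
    using nonneg by (simp_all add: summable_on_UNIV_nonneg_real_iff)
  then have "(\<lambda>(l, n). f l * g n) summable_on UNIV \<times> UNIV"
    using nonneg by (intro summable_on_mult_pair) auto
  then have "m summable_on UNIV"
    unfolding m_def case_prod_unfold using summable_on_cmult_right by fastforce
  moreover have "m i \<ge> 0" for i
    using nonneg D by (auto simp: m_def case_prod_unfold)
  moreover have "norm (rl_term a p q v i (x, y)) \<le>
      m i * (norm (rl_kernel p x) * norm (rl_kernel q y))"
    if "x \<le> A" "y \<le> B" for i x y
  proof -
    obtain l n where i: "i = (l, n)"
      by fastforce
    have 1: "norm (rl_kernel (p + of_nat l) x) \<le>
        norm (rl_kernel p x) * (norm (Gamma p) * A' ^ l / norm (Gamma (p + of_nat l)))"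
      using norm_rl_kernel_add_le[OF p, of "of_nat l" x A'] that pos by (simp add: A'_def powr_realpow)
    have 2: "norm (rl_kernel (q + v * of_nat n) y) \<le>
        norm (rl_kernel q y) * (norm (Gamma q) * (B' powr Re v) ^ n / norm (Gamma (q + v * of_nat n)))"
      using norm_rl_kernel_add_le[OF q, of "v * of_nat n" y B'] that pos v
      by (simp add: B'_def powr_powr flip: powr_realpow)
    have "norm (rl_term a p q v i (x, y)) \<le> (C * X ^ l * Y ^ n) *
        ((norm (rl_kernel p x) * (norm (Gamma p) * A' ^ l / norm (Gamma (p + of_nat l)))) *
         (norm (rl_kernel q y) * (norm (Gamma q) * (B' powr Re v) ^ n / norm (Gamma (q + v * of_nat n)))))"
      unfolding i rl_term_def prod.case norm_mult
      using 1 2 CXY pos by (intro mult_mono) (auto intro!: mult_nonneg_nonneg divide_nonneg_nonneg)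
    also have "\<dots> = m i * (norm (rl_kernel p x) * norm (rl_kernel q y))"
      by (simp add: i m_def D_def f_def g_def power_mult_distrib)
    finally show ?thesis .
  qed
  ultimately show thesis
    using that by blast
qed

lemma rl_term_abs_summable:
  assumes "geom_bounded a" "Re p > 0" "Re q > 0" "Re v > 0"
  shows "(\<lambda>i. norm (rl_term a p q v i z)) summable_on UNIV"
proof -
  obtain x y where z: "z = (x, y)"
    by fastforce
  obtain m where "m summable_on UNIV"
    "\<And>i. norm (rl_term a p q v i (x, y)) \<le> m i * (norm (rl_kernel p x) * norm (rl_kernel q y))"
    using rl_term_majorant[OF assms, of x y] by (metis order_refl)
  then show ?thesis
    unfolding z by (intro Infinite_Sum.abs_summable_on_comparison_test'[OF summable_on_cmult_left]) auto
qed

lemma rl_series_nonpos: "fst z \<le> 0 \<or> snd z \<le> 0 \<Longrightarrow> rl_series a p q v z = 0"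
  unfolding rl_series_def rl_term_def by (intro infsum_0) (auto simp: case_prod_unfold)

lemma rl_series_bound:
  assumes "geom_bounded a" "Re p > 0" "Re q > 0" "Re v > 0"
  obtains K where "K \<ge> 0"
    "\<And>x y. x \<le> A \<Longrightarrow> y \<le> B \<Longrightarrow> norm (rl_series a p q v (x, y)) \<le>
        K * (norm (rl_kernel p x) * norm (rl_kernel q y))"
proof -
  obtain m where m: "m summable_on UNIV" "\<And>i. m i \<ge> 0"
    "\<And>i x y. x \<le> A \<Longrightarrow> y \<le> B \<Longrightarrow>
      norm (rl_term a p q v i (x, y)) \<le> m i * (norm (rl_kernel p x) * norm (rl_kernel q y))"
    using rl_term_majorant[OF assms] by blast
  show thesis
  proof
    show "infsum m UNIV \<ge> 0"
      using m by (intro infsum_nonneg) auto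
    fix x y assume xy: "x \<le> A" "y \<le> B"
    have "norm (rl_series a p q v (x, y)) \<le>
        (\<Sum>\<^sub>\<infinity>i. m i * (norm (rl_kernel p x) * norm (rl_kernel q y)))"
      unfolding rl_series_def
    proof (rule norm_infsum_le[OF has_sum_infsum has_sum_infsum])
      show "(\<lambda>i. rl_term a p q v i (x, y)) summable_on UNIV"
        by (rule Infinite_Sum.abs_summable_summable) (rule rl_term_abs_summable[OF assms])
      show "(\<lambda>i. m i * (norm (rl_kernel p x) * norm (rl_kernel q y))) summable_on UNIV"
        using m(1) by (rule summable_on_cmult_left)
    qed (use m(3) xy in auto)
    also have "\<dots> = infsum m UNIV * (norm (rl_kernel p x) * norm (rl_kernel q y))"
      using m by (intro infsum_cmult_left) auto
    finally show "norm (rl_series a p q v (x, y)) \<le>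
        infsum m UNIV * (norm (rl_kernel p x) * norm (rl_kernel q y))" .
  qed
qed

lemma borel_measurable_rl_series:
  assumes "geom_bounded a" "Re p > 0" "Re q > 0" "Re v > 0"
  shows "rl_series a p q v \<in> borel_measurable borel"
proof -
  have "rl_series a p q v = (\<lambda>z. \<Sum>l. \<Sum>n. rl_term a p q v (l, n) z)"
  proof (rule ext)
    fix z
    show "rl_series a p q v z = (\<Sum>l. \<Sum>n. rl_term a p q v (l, n) z)"
      unfolding rl_series_def
      by (rule suminf_suminf_eq_infsum[OF Infinite_Sum.abs_summable_summable, symmetric])
        (rule rl_term_abs_summable[OF assms])
  qed
  also have "\<dots> \<in> borel_measurable borel"
    by measurable
  finally show ?thesis .
qed

lemma
  fixes f g :: "real \<Rightarrow> 'a::{real_normed_field, banach, second_countable_topology}"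
  assumes f: "integrable lborel f" and g: "integrable lborel g"
  shows integrable_lborel_times: "integrable lborel (\<lambda>z. f (fst z) * g (snd z))"
    and integral_lborel_times:
      "(LINT z|lborel. f (fst z) * g (snd z)) = (LINT x|lborel. f x) * (LINT y|lborel. g y)"
proof -
  have [measurable]: "f \<in> borel_measurable borel" "g \<in> borel_measurable borel"
    using f g by auto
  have int: "integrable (lborel \<Otimes>\<^sub>M lborel) (\<lambda>(x, y). f x * g y)"
  proof (rule lborel_pair.Fubini_integrable)
    show "(\<lambda>(x, y). f x * g y) \<in> borel_measurable (lborel \<Otimes>\<^sub>M lborel)"
      by measurable
    show "integrable lborel (\<lambda>x. LINT y|lborel. norm (case (x, y) of (x, y) \<Rightarrow> f x * g y))"
      using f by (simp add: norm_mult)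
    show "AE x in lborel. integrable lborel (\<lambda>y. case (x, y) of (x, y) \<Rightarrow> f x * g y)"
      using g by simp
  qed
  then show "integrable lborel (\<lambda>z. f (fst z) * g (snd z))"
    by (simp add: lborel_prod case_prod_unfold)
  have "(LINT z|(lborel \<Otimes>\<^sub>M lborel). (case z of (x, y) \<Rightarrow> f x * g y)) =
      (LINT x|lborel. LINT y|lborel. f x * g y)"
    using lborel_pair.integral_fst[OF int] by simp
  also have "\<dots> = (LINT x|lborel. f x) * (LINT y|lborel. g y)"
    by simp
  finally show "(LINT z|lborel. f (fst z) * g (snd z)) =
      (LINT x|lborel. f x) * (LINT y|lborel. g y)"
    by (simp add: lborel_prod case_prod_unfold)
qed

definition cauchy_product2 :: "(nat \<times> nat \<Rightarrow> complex) \<Rightarrow> (nat \<times> nat \<Rightarrow> complex) \<Rightarrow> nat \<times> nat \<Rightarrow> complex" where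
  "cauchy_product2 a b = (\<lambda>(L, N). \<Sum>l\<le>L. \<Sum>n\<le>N. a (l, n) * b (L - l, N - n))"

text \<open>
  Regrouping the pairs of indices by their sum.
\<close>

lemma has_sum_cauchy_product2:
  fixes a b F :: "nat \<times> nat \<Rightarrow> complex"
  assumes "((\<lambda>((l, n), (m, k)). a (l, n) * b (m, k) * F (l + m, n + k)) has_sum S) UNIV"
  shows "((\<lambda>i. cauchy_product2 a b i * F i) has_sum S) UNIV"
proof -
  define B where "B = (\<lambda>(L :: nat, N :: nat). {..L} \<times> {..N})"
  define f where "f = (\<lambda>((L, N), (l, n)). a (l, n) * b (L - l, N - n) * F (L, N))"
  define r where "r = (\<lambda>((l :: nat, n :: nat), (m, k)). ((l + m, n + k), (l, n)))"
  define r' where "r' = (\<lambda>((L :: nat, N :: nat), (l, n)). ((l, n), (L - l, N - n)))"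
  have "((\<lambda>((l, n), (m, k)). a (l, n) * b (m, k) * F (l + m, n + k)) has_sum S) UNIV \<longleftrightarrow>
      (f has_sum S) (Sigma UNIV B)"
    by (rule has_sum_reindex_bij_witness[of _ r' r]) (auto simp: r_def r'_def B_def f_def)
  with assms have "(f has_sum S) (Sigma UNIV B)"
    by blast
  moreover have "((\<lambda>j. f (i, j)) has_sum (cauchy_product2 a b i * F i)) (B i)" for i
  proof -
    obtain L N where i: "i = (L, N)"
      by fastforce
    have "cauchy_product2 a b i * F i = sum (\<lambda>j. f (i, j)) (B i)"
      by (simp add: i cauchy_product2_def B_def f_def sum.cartesian_product sum_distrib_right case_prod_unfold)
    then show ?thesis
      by (simp add: i B_def has_sum_finiteI)
  qed
  ultimately show ?thesis
    by (rule has_sum_SigmaD)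
qed

text \<open>
  Termwise convolution of the two double series. At a fixed point \<open>z = (x, y)\<close> the integrand lives
  on \<open>0 < w < z\<close>, where both majorants apply; the resulting dominating function is a product of two
  one-dimensional integrands that are integrable by \<open>integrable_rl_conv\<close>.
\<close>

lemma conv_rl_series:
  assumes a: "geom_bounded a" and b: "geom_bounded b"
    and p: "Re p > 0" and q: "Re q > 0" and s: "Re s > 0" and t: "Re t > 0" and v: "Re v > 0"
  shows "conv (rl_series a p q v) (rl_series b s t v) z =
      rl_series (cauchy_product2 a b) (p + s) (q + t) v z"
proof -
  obtain x y where z: "z = (x, y)"
    by fastforce
  obtain m1 where m1: "m1 summable_on UNIV" "\<And>i. m1 i \<ge> 0"
    "\<And>i x' y'. x' \<le> x \<Longrightarrow> y' \<le> y \<Longrightarrow>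
      norm (rl_term a p q v i (x', y')) \<le> m1 i * (norm (rl_kernel p x') * norm (rl_kernel q y'))"
    using rl_term_majorant[OF a p q v, of x y] by blast
  obtain m2 where m2: "m2 summable_on UNIV" "\<And>i. m2 i \<ge> 0"
    "\<And>i x' y'. x' \<le> x \<Longrightarrow> y' \<le> y \<Longrightarrow>
      norm (rl_term b s t v i (x', y')) \<le> m2 i * (norm (rl_kernel s x') * norm (rl_kernel t y'))"
    using rl_term_majorant[OF b s t v, of x y] by blast
  define f where "f = (\<lambda>(i, j) w. rl_term a p q v i (z - w) * rl_term b s t v j w)"
  define m where "m = (\<lambda>(i, j). m1 i * m2 j)"
  define F where "F w = norm (rl_kernel p (x - fst w) * rl_kernel s (fst w)) *
      norm (rl_kernel q (y - snd w) * rl_kernel t (snd w))"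
    for w
  have meas: "f i \<in> borel_measurable lborel" for i
    unfolding f_def case_prod_unfold by measurable
  have bound: "norm (f i w) \<le> m i * F w" for i w
  proof -
    obtain i1 i2 where i: "i = (i1, i2)"
      by (cases i)
    obtain w1 w2 where w: "w = (w1, w2)"
      by fastforce
    show ?thesis
    proof (cases "0 < w1 \<and> w1 < x \<and> 0 < w2 \<and> w2 < y")
      case True
      have "norm (f i w) \<le> (m1 i1 * (norm (rl_kernel p (x - w1)) * norm (rl_kernel q (y - w2)))) *
          (m2 i2 * (norm (rl_kernel s w1) * norm (rl_kernel t w2)))"
        unfolding f_def i w z prod.case norm_mult diff_Pair
        using True m1 m2 by (intro mult_mono) auto
      also have "\<dots> = m i * F w"
        by (simp add: i w m_def F_def norm_mult)
      finally show ?thesis .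
    next
      case False
      then have "f i w = 0"
        by (auto simp: f_def i w z rl_term_def case_prod_unfold not_less)
      moreover have "m i * F w \<ge> 0"
        using m1(2) m2(2) by (simp add: m_def i F_def)
      ultimately show ?thesis by simp
    qed
  qed
  have "m summable_on UNIV \<times> UNIV"
    unfolding m_def using m1 m2 by (intro summable_on_mult_pair) auto
  then have m: "m summable_on UNIV"
    by simp
  have F: "integrable lborel F"
    unfolding F_def using p q s t by (intro integrable_lborel_times integrable_norm integrable_rl_conv)
  have inf: "infinite (UNIV :: ((nat \<times> nat) \<times> (nat \<times> nat)) set)"
    by (simp add: finite_prod)
  have "((\<lambda>i. LINT w|lborel. f i w) has_sum (LINT w|lborel. (\<Sum>\<^sub>\<infinity>i. f i w))) UNIV"
    by (rule has_sum_integral_dominated[OF inf meas bound m F])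
  also have "(\<lambda>i. LINT w|lborel. f i w) = (\<lambda>((l, n), (m, k)). a (l, n) * b (m, k) *
      (rl_kernel (p + s + of_nat (l + m)) x * rl_kernel (q + t + v * of_nat (n + k)) y))"
  proof (intro ext, clarify)
    fix l n m k
    have "(LINT w|lborel. f ((l, n), (m, k)) w) = a (l, n) * b (m, k) *
       (LINT w|lborel. (rl_kernel (p + of_nat l) (x - fst w) * rl_kernel (s + of_nat m) (fst w)) *
        (rl_kernel (q + v * of_nat n) (y - snd w) * rl_kernel (t + v * of_nat k) (snd w)))"
      unfolding f_def z rl_term_def by (subst integral_mult_right_zero[symmetric])
        (simp add: case_prod_unfold mult_ac)
    also have "\<dots> = a (l, n) * b (m, k) * (conv (rl_kernel (p + of_nat l)) (rl_kernel (s + of_nat m)) x *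
        conv (rl_kernel (q + v * of_nat n)) (rl_kernel (t + v * of_nat k)) y)"
      unfolding conv_def using p q s t v
      by (subst integral_lborel_times) (auto intro!: integrable_rl_conv add_pos_nonneg)
    also have "conv (rl_kernel (p + of_nat l)) (rl_kernel (s + of_nat m)) x =
        rl_kernel (p + s + of_nat (l + m)) x"
      using p s by (subst conv_rl) (auto intro!: add_pos_nonneg simp: add_ac)
    also have "conv (rl_kernel (q + v * of_nat n)) (rl_kernel (t + v * of_nat k)) y =
        rl_kernel (q + t + v * of_nat (n + k)) y"
      using q t v by (subst conv_rl) (auto intro!: add_pos_nonneg simp: algebra_simps)
    finally show "(LINT w|lborel. f ((l, n), (m, k)) w) = a (l, n) * b (m, k) *
      (rl_kernel (p + s + of_nat (l + m)) x * rl_kernel (q + t + v * of_nat (n + k)) y)" .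
  qed
  also have "(LINT w|lborel. (\<Sum>\<^sub>\<infinity>i. f i w)) = conv (rl_series a p q v) (rl_series b s t v) z"
    unfolding conv_def
  proof (rule Bochner_Integration.integral_cong)
    fix w
    have "(\<Sum>\<^sub>\<infinity>i. f i w) = (\<Sum>\<^sub>\<infinity>i. \<Sum>\<^sub>\<infinity>j. f (i, j) w)"
    proof -
      have "(\<lambda>i. norm (f i w)) summable_on UNIV"
        by (rule Infinite_Sum.abs_summable_on_comparison_test'[OF summable_on_cmult_left[OF m] bound])
      then have "(\<lambda>i. f i w) summable_on Sigma UNIV (\<lambda>_. UNIV)"
        by (simp add: Infinite_Sum.abs_summable_summable)
      from infsum_Sigma_banach[OF this] show ?thesis by simp
    qed
    also have "\<dots> = (\<Sum>\<^sub>\<infinity>i. rl_term a p q v i (z - w) * rl_series b s t v w)"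
      unfolding f_def prod.case rl_series_def[of b] infsum_cmult_right' ..
    also have "\<dots> = rl_series a p q v (z - w) * rl_series b s t v w"
      unfolding rl_series_def[of a] infsum_cmult_left' ..
    finally show "(\<Sum>\<^sub>\<infinity>i. f i w) = rl_series a p q v (z - w) * rl_series b s t v w" .
  qed simp
  finally have "((\<lambda>((l, n), (m, k)). a (l, n) * b (m, k) *
      (\<lambda>(L, N). rl_kernel (p + s + of_nat L) x * rl_kernel (q + t + v * of_nat N) y) (l + m, n + k))
      has_sum conv (rl_series a p q v) (rl_series b s t v) z) UNIV"
    by simp
  from infsumI[OF has_sum_cauchy_product2[OF this]] show ?thesis
    by (simp add: rl_series_def rl_term_def z case_prod_unfold)
qed

section \<open>The coefficients of the Konhauser kernel\<close>

text \<open>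
  The Vandermonde identity, read as \<open>(1 - X) powr (- a) * (1 - X) powr (- b) = (1 - X) powr (- (a + b))\<close>.
\<close>

lemma sum_pochhammer_div_fact:
  fixes a b :: complex
  shows "(\<Sum>k\<le>n. pochhammer a k / fact k * (pochhammer b (n - k) / fact (n - k))) =
    pochhammer (a + b) n / fact n"
proof -
  have "pochhammer a k / fact k * (pochhammer b (n - k) / fact (n - k)) =
      of_nat (n choose k) * pochhammer a k * pochhammer b (n - k) / fact n" if "k \<le> n" for k
    using that by (simp add: binomial_fact field_simps)
  then show ?thesis
    unfolding pochhammer_binomial_sum sum_divide_distrib by (intro sum.cong) auto
qed

definition konhauser_coeff :: "complex \<Rightarrow> complex \<Rightarrow> complex \<Rightarrow> complex \<Rightarrow> nat \<times> nat \<Rightarrow> complex" where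
  "konhauser_coeff g1 g2 w c = (\<lambda>(l, n). (- 4 * w) ^ l * (pochhammer (g1 / 2) l / fact l) *
     (pochhammer (g2 + of_nat l) n / fact n) * c ^ n)"

text \<open>
  In the sum over \<open>n\<close> the shifts \<open>l\<close> and \<open>L - l\<close> of the two Pochhammer parameters add up to \<open>L\<close>, so the
  result does not depend on \<open>l\<close> and the sum over \<open>l\<close> is again a Vandermonde sum.
\<close>

lemma cauchy_product2_konhauser_coeff:
  "cauchy_product2 (konhauser_coeff g1 g2 w c) (konhauser_coeff m1 m2 w c) =
      konhauser_coeff (g1 + m1) (g2 + m2) w c"
proof (intro ext, clarify)
  fix L N
  have inner: "(\<Sum>n\<le>N. konhauser_coeff g1 g2 w c (l, n) * konhauser_coeff m1 m2 w c (L - l, N - n)) =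
      (- 4 * w) ^ L * c ^ N * (pochhammer (g2 + m2 + of_nat L) N / fact N) *
      (pochhammer (g1 / 2) l / fact l * (pochhammer (m1 / 2) (L - l) / fact (L - l)))"
    if "l \<le> L" for l
  proof -
    have g: "g2 + of_nat l + (m2 + of_nat (L - l)) = g2 + m2 + of_nat L"
      using that by (simp add: of_nat_diff)
    have "konhauser_coeff g1 g2 w c (l, n) * konhauser_coeff m1 m2 w c (L - l, N - n) =
        (- 4 * w) ^ L * c ^ N *
        (pochhammer (g1 / 2) l / fact l * (pochhammer (m1 / 2) (L - l) / fact (L - l))) *
        (pochhammer (g2 + of_nat l) n / fact n *
         (pochhammer (m2 + of_nat (L - l)) (N - n) / fact (N - n)))" if "n \<le> N" for n
    proof -
      have "(- 4 * w) ^ L = (- 4 * w) ^ l * (- 4 * w) ^ (L - l)" "c ^ N = c ^ n * c ^ (N - n)"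
        using that \<open>l \<le> L\<close> by (simp_all flip: power_add)
      then show ?thesis
        unfolding konhauser_coeff_def prod.case by (simp only: mult_ac)
    qed
    then have "(\<Sum>n\<le>N. konhauser_coeff g1 g2 w c (l, n) * konhauser_coeff m1 m2 w c (L - l, N - n)) =
        (- 4 * w) ^ L * c ^ N *
        (pochhammer (g1 / 2) l / fact l * (pochhammer (m1 / 2) (L - l) / fact (L - l))) *
        (\<Sum>n\<le>N. pochhammer (g2 + of_nat l) n / fact n *
         (pochhammer (m2 + of_nat (L - l)) (N - n) / fact (N - n)))"
      unfolding sum_distrib_left by (intro sum.cong) auto
    then show ?thesis
      unfolding sum_pochhammer_div_fact g by (simp only: mult_ac)
  qed
  have "cauchy_product2 (konhauser_coeff g1 g2 w c) (konhauser_coeff m1 m2 w c) (L, N) =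
      (- 4 * w) ^ L * c ^ N * (pochhammer (g2 + m2 + of_nat L) N / fact N) *
      (\<Sum>l\<le>L. pochhammer (g1 / 2) l / fact l * (pochhammer (m1 / 2) (L - l) / fact (L - l)))"
    unfolding cauchy_product2_def prod.case sum_distrib_left by (intro sum.cong inner) auto
  also have "\<dots> = konhauser_coeff (g1 + m1) (g2 + m2) w c (L, N)"
    unfolding sum_pochhammer_div_fact by (simp add: konhauser_coeff_def add_divide_distrib mult_ac)
  finally show "cauchy_product2 (konhauser_coeff g1 g2 w c) (konhauser_coeff m1 m2 w c) (L, N) =
      konhauser_coeff (g1 + m1) (g2 + m2) w c (L, N)" .
qed

lemma norm_pochhammer_le:
  fixes a :: complex
  assumes "norm a \<le> r"
  shows "norm (pochhammer a n) \<le> pochhammer r n"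
  unfolding pochhammer_prod prod_norm[symmetric]
  by (intro prod_mono conjI norm_ge_zero order_trans[OF norm_triangle_ineq]) (use assms in auto)

text \<open>
  For \<open>a = m + 1\<close> the quotient is a binomial coefficient. What matters is that the bound is
  geometric in \<open>m\<close> and \<open>n\<close> jointly, since it is used with \<open>m\<close> growing like the outer summation index.
\<close>

lemma norm_pochhammer_div_fact_le:
  fixes a :: complex
  assumes "norm a \<le> real (Suc m)"
  shows "norm (pochhammer a n / fact n) \<le> 2 ^ (m + n)"
proof -
  have "fact (m + n) = fact m * pochhammer (real (Suc m)) n"
    unfolding pochhammer_fact using pochhammer_product'[of "1 :: real" m n] by (simp add: add_ac)
  then have "pochhammer (real (Suc m)) n / fact n = real (m + n choose n)"
    by (simp add: binomial_fact)
  also have "\<dots> \<le> 2 ^ (m + n)"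
    using binomial_le_pow2[of "m + n" n] by (metis of_nat_le_iff of_nat_numeral of_nat_power)
  finally have "pochhammer (real (Suc m)) n / fact n \<le> 2 ^ (m + n)" .
  moreover have "norm (pochhammer a n / fact n) \<le> pochhammer (real (Suc m)) n / fact n"
    using norm_pochhammer_le[OF assms] by (simp add: norm_divide divide_right_mono)
  ultimately show ?thesis
    by linarith
qed

lemma geom_bounded_konhauser_coeff: "geom_bounded (konhauser_coeff g1 g2 w c)"
proof -
  obtain m1 where m1: "norm (g1 / 2) \<le> real m1"
    using real_arch_simple by blast
  obtain m2 where m2: "norm g2 \<le> real m2"
    using real_arch_simple by blast
  have "norm (konhauser_coeff g1 g2 w c (l, n)) \<le>
      2 ^ (m1 + m2) * (16 * norm w) ^ l * (2 * norm c) ^ n" for l n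
  proof -
    have "norm (g2 + of_nat l) \<le> real (Suc (m2 + l))"
      by (rule order_trans[OF norm_triangle_ineq]) (use m2 in simp)
    then have b2: "norm (pochhammer (g2 + of_nat l) n / fact n) \<le> 2 ^ (m2 + l + n)"
      by (rule norm_pochhammer_div_fact_le)
    have b1: "norm (pochhammer (g1 / 2) l / fact l) \<le> 2 ^ (m1 + l)"
      using m1 by (intro norm_pochhammer_div_fact_le) simp
    have "norm (konhauser_coeff g1 g2 w c (l, n)) =
        (4 * norm w) ^ l * norm (pochhammer (g1 / 2) l / fact l) *
        norm (pochhammer (g2 + of_nat l) n / fact n) * norm c ^ n"
      unfolding konhauser_coeff_def prod.case norm_mult norm_power by simp
    also have "\<dots> \<le> (4 * norm w) ^ l * 2 ^ (m1 + l) * 2 ^ (m2 + l + n) * norm c ^ n"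
      using b1 b2 by (intro mult_mono mult_nonneg_nonneg) auto
    also have "\<dots> = 2 ^ (m1 + m2) * ((2 * 2 * (4 * norm w)) ^ l) * (2 * norm c) ^ n"
      unfolding power_mult_distrib power_add by (simp only: mult_ac)
    finally show ?thesis by simp
  qed
  then show ?thesis
    unfolding geom_bounded_def by (intro exI[of _ "2 ^ (m1 + m2)"] exI[of _ "16 * norm w"] exI[of _ "2 * norm c"]) auto
qed

text \<open>
  The powers in front of the kernel function complete each of its terms to a product of
  Riemann-Liouville kernels.
\<close>

lemma rl_series_konhauser_coeff:
  assumes p: "Re p > 0" and q: "Re q > 0" and v: "Re v > 0" and x: "x > 0" and y: "y > 0"
  shows "of_real y powr (q - 1) * of_real x powr (p - 1) *
      konhauser_kernel g1 g2 g3 p q v (w * of_real x) c y = rl_series (konhauser_coeff g1 g2 w c) p q v (x, y)"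
proof -
  define k where "k = complex_of_real y powr (q - 1) * of_real x powr (p - 1)"
  define T where "T = (\<lambda>(l, n). (-4) ^ l * pochhammer (g1 / 2) l * pochhammer (g2 + of_nat l) n *
                (w * of_real x) ^ l * (c ^ n * of_real y powr (v * of_nat n)) /
                (Gamma (p + of_nat l) * Gamma (q + v * of_nat n) * fact n * fact l))"
  have "k \<noteq> 0"
    using x y by (simp add: k_def)
  have term_eq: "rl_term (konhauser_coeff g1 g2 w c) p q v i (x, y) = k * T i" for i
  proof -
    obtain l n where i: "i = (l, n)"
      by fastforce
    have "complex_of_real x powr (p + of_nat l - 1) = of_real x powr (p - 1) * of_real x ^ l"
      using x by (simp add: powr_diff powr_add powr_nat)
    moreover have "complex_of_real y powr (q + v * of_nat n - 1) =
        of_real y powr (q - 1) * of_real y powr (v * of_nat n)"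
      using y by (simp add: powr_diff powr_add)
    ultimately show ?thesis
      using x y unfolding rl_term_def konhauser_coeff_def T_def k_def i rl_kernel_def
      by (simp add: power_mult_distrib mult_ac) (simp flip: power_mult_distrib)
  qed
  have "(\<lambda>i. k * T i) summable_on UNIV"
    using Infinite_Sum.abs_summable_summable[OF rl_term_abs_summable[OF geom_bounded_konhauser_coeff p q v]]
    by (simp add: term_eq[symmetric])
  then have "(\<lambda>i. inverse k * (k * T i)) summable_on UNIV"
    by (rule summable_on_cmult_right)
  then have "T summable_on UNIV"
    using \<open>k \<noteq> 0\<close> by (simp flip: mult.assoc)
  then have "konhauser_kernel g1 g2 g3 p q v (w * of_real x) c y = (\<Sum>\<^sub>\<infinity>i. T i)"
    unfolding konhauser_kernel_def by (subst suminf_suminf_eq_infsum[symmetric]) (auto simp: T_def)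
  then show ?thesis
    unfolding rl_series_def term_eq k_def by (simp add: infsum_cmult_right')
qed

section \<open>The integral operators as convolutions\<close>

text \<open>
  Measurability of \<open>f\<close> follows from completeness of Lebesgue measure. Both
  integrands of an operator are of this kind, as \<open>d\<close> agrees with a Borel function only almost everywhere.
\<close>

lemma integral_lebesgue_eq_lborel:
  fixes f g :: "'a::euclidean_space \<Rightarrow> complex"
  assumes [measurable]: "g \<in> borel_measurable borel" and ae: "AE x in lborel. f x = g x"
  shows "(LINT x|lebesgue. f x) = (LINT x|lborel. g x)"
proof -
  have g: "g \<in> borel_measurable lebesgue"
    by (rule measurable_completion) simp
  have ae': "AE x in lebesgue. f x = g x"
    using ae by (rule AE_completion)
  have "f \<in> borel_measurable lebesgue"
  proof (rule measurableI)
    fix S :: "complex set"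
    assume "S \<in> sets borel"
    then have "g -` S \<in> sets lebesgue"
      using measurable_sets[OF g] by simp
    moreover have "AE x in lebesgue. x \<in> g -` S \<longleftrightarrow> x \<in> f -` S"
      using ae' by eventually_elim simp
    ultimately show "f -` S \<inter> space lebesgue \<in> sets lebesgue"
      using completion.in_sets_AE[of "g -` S" "f -` S" lborel] by simp
  qed simp
  then have "(LINT x|lebesgue. f x) = (LINT x|lebesgue. g x)"
    using g ae' by (rule integral_cong_AE)
  also have "\<dots> = (LINT x|lborel. g x)"
    by (rule integral_completion) simp
  finally show ?thesis .
qed

lemma lebesgue_integrable_borel_version:
  fixes d :: "'a::euclidean_space \<Rightarrow> complex"
  assumes R: "R \<in> sets borel" and d: "set_integrable lebesgue R d"
  obtains D where "integrable lborel D" "\<And>x. x \<notin> R \<Longrightarrow> D x = 0" "AE x in lborel. x \<in> R \<longrightarrow> d x = D x"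
proof -
  define f where "f x = indicator R x *\<^sub>R d x" for x
  have f: "integrable lebesgue f"
    using d unfolding set_integrable_def f_def .
  then have "(\<lambda>x. Re (f x)) \<in> borel_measurable lebesgue" "(\<lambda>x. Im (f x)) \<in> borel_measurable lebesgue"
    by auto
  then obtain r i where r [measurable]: "r \<in> borel_measurable lborel" and rf: "AE x in lborel. Re (f x) = r x"
    and i [measurable]: "i \<in> borel_measurable lborel" and "if": "AE x in lborel. Im (f x) = i x"
    using completion_ex_borel_measurable_real[of "\<lambda>x. Re (f x)"]
      completion_ex_borel_measurable_real[of "\<lambda>x. Im (f x)"] by blast
  define D where "D x = indicator R x *\<^sub>R Complex (r x) (i x)" for x
  have D_meas: "D \<in> borel_measurable lborel"
    unfolding D_def Complex_eq using R by measurable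
  have ae: "AE x in lborel. f x = D x"
    using rf "if" by eventually_elim (auto simp: D_def f_def complex_eq_iff indicator_def split: if_splits)
  have "integrable lebesgue f \<longleftrightarrow> integrable lebesgue D"
    by (rule integrable_cong_AE) (use f D_meas ae in \<open>auto intro: measurable_completion AE_completion\<close>)
  with f have "integrable lborel D"
    using integrable_completion[OF D_meas] by simp
  moreover have "AE x in lborel. x \<in> R \<longrightarrow> d x = D x"
    using ae by eventually_elim (auto simp: f_def)
  ultimately show thesis
    using that by (simp add: D_def)
qed

text \<open>
  The null set is first enlarged to a Borel one, because exchanging the two almost-everywhere
  quantifiers requires measurability.
\<close>

lemma AE_lborel_prod_section:
  fixes P :: "real \<times> real \<Rightarrow> bool"
  assumes "AE z in lborel. P z"
  shows "AE y in lborel. AE x in lborel. P (x, y)"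
proof -
  obtain N where N: "N \<in> null_sets lborel" "{z. \<not> P z} \<subseteq> N"
    using assms by (auto simp: eventually_ae_filter)
  then have "N \<in> null_sets (lborel \<Otimes>\<^sub>M lborel)"
    by (simp add: lborel_prod)
  then have "AE z in lborel \<Otimes>\<^sub>M lborel. z \<notin> N"
    by (rule AE_not_in)
  then have "AE x in lborel. AE y in lborel. (x, y) \<notin> N"
    by (rule lborel_pair.AE_pair)
  moreover have "{z \<in> space (lborel \<Otimes>\<^sub>M lborel). (fst z, snd z) \<notin> N} \<in> sets (lborel \<Otimes>\<^sub>M lborel)"
  proof -
    have "{z \<in> space (lborel \<Otimes>\<^sub>M lborel). (fst z, snd z) \<notin> N} = space lborel - N"
      by (auto simp: space_pair_measure)
    also have "\<dots> \<in> sets lborel"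
      using N(1) by (intro sets.compl_sets) auto
    finally show ?thesis
      by (simp only: lborel_prod)
  qed
  ultimately have "AE y in lborel. AE x in lborel. (x, y) \<notin> N"
    using lborel_pair.AE_commute[of "\<lambda>x y. (x, y) \<notin> N"] by blast
  then show ?thesis
    using N(2) by (auto elim!: eventually_mono)
qed

text \<open>
  The kernels are in general not integrable on the whole quadrant, but they are on every box, and
  \<open>AE_conv_assoc\<close> needs integrability.
\<close>

definition box_trunc :: "real \<Rightarrow> real \<Rightarrow> (real \<times> real \<Rightarrow> complex) \<Rightarrow> real \<times> real \<Rightarrow> complex" where
  "box_trunc A B k z = (if z \<in> {0<..<A} \<times> {0<..<B} then k z else 0)"

lemma box_trunc_rl_series:
  "fst z < A \<Longrightarrow> snd z < B \<Longrightarrow> box_trunc A B (rl_series a p q v) z = rl_series a p q v z"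
  by (cases z) (auto simp: box_trunc_def rl_series_nonpos)

lemma box_trunc_nonpos: "fst z \<le> 0 \<or> snd z \<le> 0 \<Longrightarrow> box_trunc A B k z = 0"
  by (auto simp: box_trunc_def)

lemma integrable_box_trunc_rl_series:
  assumes a: "geom_bounded a" and p: "Re p > 0" and q: "Re q > 0" and v: "Re v > 0"
  shows "integrable lborel (box_trunc A B (rl_series a p q v))"
proof -
  obtain K where K: "K \<ge> 0"
    "\<And>x y. x \<le> A \<Longrightarrow> y \<le> B \<Longrightarrow> norm (rl_series a p q v (x, y)) \<le>
        K * (norm (rl_kernel p x) * norm (rl_kernel q y))"
    using rl_series_bound[OF assms] by blast
  \<comment> \<open>On a bounded interval the factor \<open>exp (- x)\<close> costs only a constant.\<close>
  define e where "e b x = norm (rl_kernel b x * of_real (exp (- x)))" for b x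
  define F where "F z = K * exp A * exp B * (e p (fst z) * e q (snd z))" for z
  have rl_kernel_le: "norm (rl_kernel b x) \<le> exp C * e b x" if "x \<le> C" for b x C
  proof -
    have "norm (rl_kernel b x) * 1 \<le> norm (rl_kernel b x) * exp (C - x)"
      using that by (intro mult_left_mono) auto
    then show ?thesis
      unfolding e_def norm_mult norm_of_real by (simp add: exp_diff exp_minus divide_inverse mult_ac)
  qed
  have "{0<..<A} \<times> {0<..<B} \<in> sets borel"
    by (intro borel_open open_Times) auto
  then have meas: "box_trunc A B (rl_series a p q v) \<in> borel_measurable lborel"
    using borel_measurable_rl_series[OF assms] unfolding box_trunc_def [abs_def] by measurable
  have "integrable lborel F"
    unfolding F_def e_def using p q
    by (intro integrable_mult_right integrable_lborel_times integrable_norm integrable_rl_exp)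
  then show ?thesis
  proof (rule Bochner_Integration.integrable_bound[OF _ meas], intro AE_I2)
    fix z :: "real \<times> real"
    obtain x y where z: "z = (x, y)"
      by fastforce
    show "norm (box_trunc A B (rl_series a p q v) z) \<le> norm (F z)"
    proof (cases "z \<in> {0<..<A} \<times> {0<..<B}")
      case True
      have "norm (rl_series a p q v (x, y)) \<le> K * (norm (rl_kernel p x) * norm (rl_kernel q y))"
        using True by (intro K) (auto simp: z)
      also have "\<dots> \<le> K * ((exp A * e p x) * (exp B * e q y))"
        using True K by (intro mult_left_mono mult_mono rl_kernel_le) (auto simp: z e_def)
      also have "\<dots> = F z"
        by (simp add: F_def z)
      finally show ?thesis
        using True by (simp add: box_trunc_def z)
    qed (simp add: box_trunc_def del: mem_Times_iff)
  qed
qed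

text \<open>
  Fubini, in the order of integration of the operator. The limits of integration are encoded by
  the supports: \<open>k (z - x, t - y)\<close> vanishes for \<open>x \<ge> z\<close> or \<open>y \<ge> t\<close>, and
  \<open>D (x, y)\<close> for \<open>x \<le> a1\<close> or \<open>y \<le> b1\<close>. Integrability of the integrand on the plane is a hypothesis, since it holds only for almost every \<open>(z, t)\<close>.
\<close>

lemma konhauser_op_eq_conv:
  fixes d D :: "real \<times> real \<Rightarrow> complex" and a1 a2 b1 b2 :: real and g1 g2 w c p q v :: complex
  defines "k \<equiv> box_trunc (a2 - a1) (b2 - b1) (rl_series (konhauser_coeff g1 g2 w c) p q v)"
  assumes p: "Re p > 0" and q: "Re q > 0" and v: "Re v > 0"
    and zt: "(z, t) \<in> {a1<..<a2} \<times> {b1<..<b2}"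
    and D0: "\<And>u. u \<notin> {a1<..<a2} \<times> {b1<..<b2} \<Longrightarrow> D u = 0"
    and dD: "AE u in lborel. u \<in> {a1<..<a2} \<times> {b1<..<b2} \<longrightarrow> d u = D u"
    and int: "integrable lborel (\<lambda>u. k ((z, t) - u) * D u)"
  shows "konhauser_op g1 g2 g3 p q v w c a1 b1 d (z, t) = conv k D (z, t)"
proof -
  define H where "H x y = k (z - x, t - y) * D (x, y)" for x y
  define G where "G y = (LINT x|lborel. H x y)" for y
  define K where "K x y = of_real (t - y) powr (q - 1) * of_real (z - x) powr (p - 1) *
       konhauser_kernel g1 g2 g3 p q v (w * of_real (z - x)) c (t - y) * d (x, y)" for x y
  have H_int: "integrable (lborel \<Otimes>\<^sub>M lborel) (\<lambda>(x, y). H x y)"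
    using int by (simp add: lborel_prod H_def case_prod_unfold minus_prod_def)
  have H_meas [measurable]: "(\<lambda>(x, y). H x y) \<in> borel_measurable (lborel \<Otimes>\<^sub>M lborel)"
    using H_int by auto
  have [measurable]: "(\<lambda>x. H x y) \<in> borel_measurable borel" for y
  proof -
    have "(\<lambda>x. case (x, y) of (x, y) \<Rightarrow> H x y) \<in> borel_measurable lborel"
      by measurable
    then show ?thesis by simp
  qed
  have [measurable]: "G \<in> borel_measurable borel"
    unfolding G_def using lborel_pair.integrable_snd[OF H_int] by auto
  have H0: "H x y = 0" if "\<not> (a1 < x \<and> x < z \<and> b1 < y \<and> y < t)" for x y
    using that D0[of "(x, y)"] by (auto simp: H_def k_def box_trunc_def)
  have HK: "K x y = H x y"
    if "a1 < x" "x < z" "b1 < y" "y < t" "(x, y) \<in> {a1<..<a2} \<times> {b1<..<b2} \<longrightarrow> d (x, y) = D (x, y)"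
    for x y
  proof -
    have "k (z - x, t - y) = rl_series (konhauser_coeff g1 g2 w c) p q v (z - x, t - y)"
      unfolding k_def using that zt by (intro box_trunc_rl_series) auto
    moreover have "d (x, y) = D (x, y)"
      using that zt by auto
    ultimately show ?thesis
      unfolding K_def H_def using rl_series_konhauser_coeff[OF p q v, of "z - x" "t - y" g1 g2 g3 w c] that by simp
  qed
  have inner: "AE y in lborel. indicator {b1<..<t} y *\<^sub>R (LINT x:{a1<..<z}|lebesgue. K x y) = G y"
    using AE_lborel_prod_section[OF dD]
  proof eventually_elim
    case (elim y)
    show ?case
    proof (cases "b1 < y \<and> y < t")
      case True
      have "AE x in lborel. indicator {a1<..<z} x *\<^sub>R K x y = H x y"
        using elim
      proof eventually_elim
        case (elim x)
        then show ?case
          using True HK[of x y] H0[of x y] by (auto simp: indicator_def)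
      qed
      then have "(LINT x:{a1<..<z}|lebesgue. K x y) = G y"
        unfolding set_lebesgue_integral_def G_def by (intro integral_lebesgue_eq_lborel) measurable
      with True show ?thesis by simp
    next
      case False
      then show ?thesis
        using H0[of _ y] by (auto simp: G_def indicator_def)
    qed
  qed
  have "konhauser_op g1 g2 g3 p q v w c a1 b1 d (z, t) =
      (LINT y:{b1<..<t}|lebesgue. LINT x:{a1<..<z}|lebesgue. K x y)"
    by (simp add: konhauser_op_def K_def)
  also have "\<dots> = (LINT y|lborel. G y)"
    unfolding set_lebesgue_integral_def[of _ "{b1<..<t}"]
    using inner by (intro integral_lebesgue_eq_lborel) measurable
  also have "\<dots> = (LINT u|(lborel \<Otimes>\<^sub>M lborel). (case u of (x, y) \<Rightarrow> H x y))"
    unfolding G_def using lborel_pair.integral_snd[OF H_int] .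
  also have "\<dots> = conv k D (z, t)"
    by (simp add: conv_def lborel_prod H_def case_prod_unfold minus_prod_def)
  finally show ?thesis .
qed

text \<open>
  Both kernels vanish off the positive quadrant, so at a point \<open>z\<close> below the corner of the box
  only their values at points below \<open>z\<close>, inside the box, contribute to the convolution.
\<close>

lemma conv_box_trunc_rl_series:
  assumes "geom_bounded a" "geom_bounded b"
    and "Re p > 0" "Re q > 0" "Re s > 0" "Re t > 0" "Re v > 0"
    and z: "fst z < A" "snd z < B"
  shows "conv (box_trunc A B (rl_series a p q v)) (box_trunc A B (rl_series b s t v)) z =
    box_trunc A B (rl_series (cauchy_product2 a b) (p + s) (q + t) v) z"
proof -
  have "box_trunc A B (rl_series a p q v) (z - w) * box_trunc A B (rl_series b s t v) w =
      rl_series a p q v (z - w) * rl_series b s t v w" for w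
  proof -
    consider "fst w \<le> 0 \<or> snd w \<le> 0" | "fst z \<le> fst w \<or> snd z \<le> snd w"
      | "0 < fst w" "0 < snd w" "fst w < fst z" "snd w < snd z"
      by linarith
    then show ?thesis
    proof cases
      case 1
      then show ?thesis by (simp add: box_trunc_nonpos rl_series_nonpos)
    next
      case 2
      then have "fst (z - w) \<le> 0 \<or> snd (z - w) \<le> 0" by auto
      then show ?thesis by (simp add: box_trunc_nonpos rl_series_nonpos)
    next
      case 3
      with z have "fst (z - w) < A" "snd (z - w) < B" "fst w < A" "snd w < B" by auto
      then show ?thesis by (simp add: box_trunc_rl_series)
    qed
  qed
  then have "conv (box_trunc A B (rl_series a p q v)) (box_trunc A B (rl_series b s t v)) z =
      conv (rl_series a p q v) (rl_series b s t v) z"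
    unfolding conv_def by simp
  also have "\<dots> = rl_series (cauchy_product2 a b) (p + s) (q + t) v z"
    by (rule conv_rl_series) fact+
  also have "\<dots> = box_trunc A B (rl_series (cauchy_product2 a b) (p + s) (q + t) v) z"
    using z by (simp add: box_trunc_rl_series)
  finally show ?thesis .
qed

lemma AE_konhauser_op_eq_conv:
  fixes d D :: "real \<times> real \<Rightarrow> complex" and a1 a2 b1 b2 :: real and g1 g2 w c p q v :: complex
  defines "k \<equiv> box_trunc (a2 - a1) (b2 - b1) (rl_series (konhauser_coeff g1 g2 w c) p q v)"
  assumes p: "Re p > 0" and q: "Re q > 0" and v: "Re v > 0"
    and D: "integrable lborel D" and D0: "\<And>u. u \<notin> {a1<..<a2} \<times> {b1<..<b2} \<Longrightarrow> D u = 0"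
    and dD: "AE u in lborel. u \<in> {a1<..<a2} \<times> {b1<..<b2} \<longrightarrow> d u = D u"
  shows "AE u in lborel. u \<in> {a1<..<a2} \<times> {b1<..<b2} \<longrightarrow>
    konhauser_op g1 g2 g3 p q v w c a1 b1 d u = conv k D u"
proof -
  have "integrable lborel k"
    unfolding k_def by (intro integrable_box_trunc_rl_series geom_bounded_konhauser_coeff p q v)
  from AE_integrable_conv[OF this D] show ?thesis
  proof eventually_elim
    case (elim u)
    obtain z t where u: "u = (z, t)"
      by fastforce
    show ?case
      using konhauser_op_eq_conv[OF p q v, of z t a1 a2 b1 b2 D d g1 g2 w c g3] D0 dD elim
      unfolding u k_def by blast
  qed
qed

text \<open>
  The inner operator is again an integrable function on the rectangle, the convolution \<open>conv k2 D\<close> cut off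
  to it, so the outer one is also a convolution, and associativity applies. Cutting off does no harm: a
  point \<open>x\<close> outside the rectangle with \<open>conv k2 D x\<close> nonzero lies above or to the right of it, where the
  outer kernel at \<open>u - x\<close> vanishes.
\<close>

theorem konhauser_op_comp:
  fixes d :: "real \<times> real \<Rightarrow> complex" and a1 a2 b1 b2 :: real
  assumes p: "Re p > 0" and q: "Re q > 0" and v: "Re v > 0" and s: "Re s > 0" and t: "Re t > 0"
    and d: "set_integrable lebesgue ({a1<..<a2} \<times> {b1<..<b2}) d"
  shows "AE u\<in>{a1<..<a2} \<times> {b1<..<b2} in lebesgue.
    konhauser_op g1 g2 g3 p q v w c a1 b1 (konhauser_op m1 m2 m3 s t v w c a1 b1 d) u =
    konhauser_op (g1 + m1) (g2 + m2) (g3 + m3) (p + s) (q + t) v w c a1 b1 d u"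
proof -
  define R where "R = {a1<..<a2} \<times> {b1<..<b2}"
  define A where "A = a2 - a1"
  define B where "B = b2 - b1"
  define k1 where "k1 = box_trunc A B (rl_series (konhauser_coeff g1 g2 w c) p q v)"
  define k2 where "k2 = box_trunc A B (rl_series (konhauser_coeff m1 m2 w c) s t v)"
  define k3 where "k3 =
      box_trunc A B (rl_series (konhauser_coeff (g1 + m1) (g2 + m2) w c) (p + s) (q + t) v)"
  have R: "R \<in> sets borel"
    unfolding R_def by (intro borel_open open_Times) auto
  obtain D where D: "integrable lborel D" and D0: "\<And>u. u \<notin> R \<Longrightarrow> D u = 0"
    and dD: "AE u in lborel. u \<in> R \<longrightarrow> d u = D u"
    using lebesgue_integrable_borel_version[OF R d[folded R_def]] by blast
  define E where "E u = indicator R u *\<^sub>R conv k2 D u" for u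
  have k: "integrable lborel k1" "integrable lborel k2"
    unfolding k1_def k2_def by (intro integrable_box_trunc_rl_series geom_bounded_konhauser_coeff p q v s t)+
  have E: "integrable lborel E"
    unfolding E_def using R integrable_conv[OF k(2) D] by (intro integrable_mult_indicator) auto
  have E0: "E u = 0" if "u \<notin> R" for u
    using that by (simp add: E_def)
  have inner: "AE u in lborel. u \<in> R \<longrightarrow> konhauser_op m1 m2 m3 s t v w c a1 b1 d u = conv k2 D u"
    unfolding R_def k2_def A_def B_def
    by (rule AE_konhauser_op_eq_conv[OF s t v D D0[unfolded R_def] dD[unfolded R_def]])
  then have inner': "AE u in lborel. u \<in> R \<longrightarrow> konhauser_op m1 m2 m3 s t v w c a1 b1 d u = E u"
    by eventually_elim (simp add: E_def)
  have outer: "AE u in lborel. u \<in> R \<longrightarrow>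
      konhauser_op g1 g2 g3 p q v w c a1 b1 (konhauser_op m1 m2 m3 s t v w c a1 b1 d) u = conv k1 E u"
    unfolding R_def k1_def A_def B_def
    by (rule AE_konhauser_op_eq_conv[OF p q v E E0[unfolded R_def] inner'[unfolded R_def]])
  have ps: "Re (p + s) > 0" "Re (q + t) > 0"
    using p q s t by auto
  have combined: "AE u in lborel. u \<in> R \<longrightarrow>
      konhauser_op (g1 + m1) (g2 + m2) (g3 + m3) (p + s) (q + t) v w c a1 b1 d u = conv k3 D u"
    unfolding R_def k3_def A_def B_def
    by (rule AE_konhauser_op_eq_conv[OF ps v D D0[unfolded R_def] dD[unfolded R_def]])
  have restrict: "conv k1 E u = conv k1 (conv k2 D) u" if u: "u \<in> R" for u
  proof -
    have "k1 (u - x) * E x = k1 (u - x) * conv k2 D x" for x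
    proof (cases "x \<in> R")
      case False
      show ?thesis
      proof (cases "fst (u - x) \<le> 0 \<or> snd (u - x) \<le> 0")
        case True
        then show ?thesis by (simp add: k1_def box_trunc_nonpos)
      next
        case pos: False
        have "k2 (x - y) * D y = 0" for y
        proof (cases "y \<in> R")
          case True
          with pos u False have "fst (x - y) \<le> 0 \<or> snd (x - y) \<le> 0"
            by (cases u; cases x; cases y) (auto simp: R_def)
          then show ?thesis by (simp add: k2_def box_trunc_nonpos)
        qed (simp add: D0)
        then have "conv k2 D x = 0"
          unfolding conv_def by (simp only: integral_zero)
        then show ?thesis
          using False by (simp add: E_def)
      qed
    qed (simp add: E_def)
    then show ?thesis
      unfolding conv_def[of k1] by (simp only:)
  qed
  have product: "conv (conv k1 k2) D u = conv k3 D u" if u: "u \<in> R" for u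
  proof -
    have "conv k1 k2 (u - x) * D x = k3 (u - x) * D x" for x
    proof (cases "x \<in> R")
      case True
      with u have "fst (u - x) < A" "snd (u - x) < B"
        by (auto simp: R_def A_def B_def)
      then show ?thesis
        unfolding k1_def k2_def k3_def cauchy_product2_konhauser_coeff[symmetric]
        by (subst conv_box_trunc_rl_series) (auto intro: geom_bounded_konhauser_coeff p q s t v)
    qed (simp add: D0)
    then show ?thesis
      unfolding conv_def[of _ D] by (simp only:)
  qed
  have "AE u in lborel. u \<in> R \<longrightarrow>
      konhauser_op g1 g2 g3 p q v w c a1 b1 (konhauser_op m1 m2 m3 s t v w c a1 b1 d) u =
      konhauser_op (g1 + m1) (g2 + m2) (g3 + m3) (p + s) (q + t) v w c a1 b1 d u"
    using outer combined AE_conv_assoc[OF k D]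
    by eventually_elim (simp add: restrict product)
  then show ?thesis
    unfolding R_def by (rule AE_completion)
qed

lemma konhauser_kernel_zero:
  assumes "y > 0"
  shows "konhauser_kernel 0 0 g3 p q v z c y = 1 / (Gamma p * Gamma q)"
proof -
  define T where "T l n = (-4) ^ l * pochhammer (0 / 2) l * pochhammer (0 + of_nat l) n *
                z ^ l * (c ^ n * of_real y powr (v * of_nat n)) /
                (Gamma (p + of_nat l) * Gamma (q + v * of_nat n) * fact n * fact l)" for l n
  have T: "T l n = (if l = 0 \<and> n = 0 then 1 / (Gamma p * Gamma q) else 0)" for l n
    using assms by (auto simp: T_def pochhammer_0_left)
  have "(\<Sum>n. T l n) = (if l = 0 then 1 / (Gamma p * Gamma q) else 0)" for l
    by (subst suminf_finite[of "{0}"]) (auto simp: T)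
  then have "(\<Sum>l. \<Sum>n. T l n) = 1 / (Gamma p * Gamma q)"
    by (subst suminf_finite[of "{0}"]) auto
  then show ?thesis
    by (simp add: konhauser_kernel_def T_def)
qed

lemma konhauser_op_zero: "konhauser_op 0 0 0 p q v w c a1 b1 d = frac_int2 p q a1 b1 d"
proof (intro ext, clarify)
  fix z t
  have inner: "(LINT x:{a1<..<z}|lebesgue. of_real (t - y) powr (q - 1) * of_real (z - x) powr (p - 1) *
       konhauser_kernel 0 0 0 p q v (w * of_real (z - x)) c (t - y) * d (x, y)) =
      1 / (Gamma p * Gamma q) * (LINT x:{a1<..<z}|lebesgue.
       of_real (z - x) powr (p - 1) * of_real (t - y) powr (q - 1) * d (x, y))"
    if "y < t" for y
    using that unfolding set_lebesgue_integral_def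
    by (subst integral_mult_right_zero [symmetric]) (simp add: konhauser_kernel_zero mult_ac)
  have "konhauser_op 0 0 0 p q v w c a1 b1 d (z, t) =
      (LINT y:{b1<..<t}|lebesgue. 1 / (Gamma p * Gamma q) * (LINT x:{a1<..<z}|lebesgue.
       of_real (z - x) powr (p - 1) * of_real (t - y) powr (q - 1) * d (x, y)))"
    unfolding konhauser_op_def prod.case set_lebesgue_integral_def[of _ "{b1<..<t}"]
  proof (rule Bochner_Integration.integral_cong)
    fix y
    show "indicator {b1<..<t} y *\<^sub>R (LINT x:{a1<..<z}|lebesgue.
        of_real (t - y) powr (q - 1) * of_real (z - x) powr (p - 1) *
        konhauser_kernel 0 0 0 p q v (w * of_real (z - x)) c (t - y) * d (x, y)) =
      indicator {b1<..<t} y *\<^sub>R (1 / (Gamma p * Gamma q) * (LINT x:{a1<..<z}|lebesgue.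
        of_real (z - x) powr (p - 1) * of_real (t - y) powr (q - 1) * d (x, y)))"
      by (cases "y < t") (simp_all only: inner, simp_all)
  qed simp
  then show "konhauser_op 0 0 0 p q v w c a1 b1 d (z, t) = frac_int2 p q a1 b1 d (z, t)"
    unfolding frac_int2_def prod.case set_integral_mult_right .
qed

theorem theorem60:
  fixes p q \<upsilon> \<sigma> \<tau> w1 w2 c \<gamma>1 \<gamma>2 \<gamma>3 \<mu>1 \<mu>2 \<mu>3 :: complex
    and a1 a2 b1 b2 :: real
    and d :: "real \<times> real \<Rightarrow> complex"
  assumes "Re p > 0" "Re q > 0" "Re \<upsilon> > 0" "Re \<sigma> > 0" "Re \<tau> > 0"
    and "a1 < a2" "b1 < b2"
    and "is_cpower w2 \<upsilon> c"
    and "set_integrable lebesgue ({a1<..<a2} \<times> {b1<..<b2}) d"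
  shows "(AE x\<in>{a1<..<a2} \<times> {b1<..<b2} in lebesgue.
            konhauser_op \<gamma>1 \<gamma>2 \<gamma>3 p q \<upsilon> w1 c a1 b1
              (konhauser_op \<mu>1 \<mu>2 \<mu>3 \<sigma> \<tau> \<upsilon> w1 c a1 b1 d) x =
            konhauser_op (\<gamma>1 + \<mu>1) (\<gamma>2 + \<mu>2) (\<gamma>3 + \<mu>3) (p + \<sigma>) (q + \<tau>) \<upsilon> w1 c a1 b1 d x) \<and>
         (AE x\<in>{a1<..<a2} \<times> {b1<..<b2} in lebesgue.
            konhauser_op \<gamma>1 \<gamma>2 \<gamma>3 p q \<upsilon> w1 c a1 b1
              (konhauser_op (- \<gamma>1) (- \<gamma>2) (- \<gamma>3) \<sigma> \<tau> \<upsilon> w1 c a1 b1 d) x =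
            frac_int2 (p + \<sigma>) (q + \<tau>) a1 b1 d x)"
proof
  note comp = konhauser_op_comp[OF assms(1-5,9)]
  show "AE x\<in>{a1<..<a2} \<times> {b1<..<b2} in lebesgue.
      konhauser_op \<gamma>1 \<gamma>2 \<gamma>3 p q \<upsilon> w1 c a1 b1
        (konhauser_op \<mu>1 \<mu>2 \<mu>3 \<sigma> \<tau> \<upsilon> w1 c a1 b1 d) x =
      konhauser_op (\<gamma>1 + \<mu>1) (\<gamma>2 + \<mu>2) (\<gamma>3 + \<mu>3) (p + \<sigma>) (q + \<tau>) \<upsilon> w1 c a1 b1 d x"
    by (rule comp)
  show "AE x\<in>{a1<..<a2} \<times> {b1<..<b2} in lebesgue.
      konhauser_op \<gamma>1 \<gamma>2 \<gamma>3 p q \<upsilon> w1 c a1 b1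
        (konhauser_op (- \<gamma>1) (- \<gamma>2) (- \<gamma>3) \<sigma> \<tau> \<upsilon> w1 c a1 b1 d) x =
      frac_int2 (p + \<sigma>) (q + \<tau>) a1 b1 d x"
    using comp[where ?m1.0 = "- \<gamma>1" and ?m2.0 = "- \<gamma>2" and ?m3.0 = "- \<gamma>3"
      and ?g1.0 = \<gamma>1 and ?g2.0 = \<gamma>2 and ?g3.0 = \<gamma>3]
    by (simp add: konhauser_op_zero)
qed

end
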